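(* Let $n\ge 2$, let $\Omega\subset\mathbb R^n$ be a smooth bounded domain, and let $B,H,f$ satisfy the standing assumptions (i)–(viii) listed in the context. Let $u\in C^1(\overline\Omega)$ be a weak solution of $-\operatorname{div}\big(B'(H(\nabla u))\nabla H(\nabla u)\big)=f(u)$ in $\Omega$, with $u>0$ in $\Omega$ and $u=0$ on $\partial\Omega$. Let $y\in\partial\Omega$ be a point at which $\Omega$ satisfies the interior sphere condition, and let $\nu$ denote the inner unit normal to $\partial\Omega$ at $y$. Then $$\frac{\partial u}{\partial\nu}(y)>0 .$$
   Context: Standing assumptions: (i) $B\in C^{3,\beta_0}_{loc}((0,+\infty))\cap C^1([0,+\infty))$ for some $\beta_0\in(0,1)$. (ii) $B(0)=B'(0)=0$ and $B(t),B'(t),B''(t)>0$ for all $t>0$. (iii) There exist $p>1$, $k\in[0,1]$, $\gamma_0>0$, $\Gamma_0>0$ such that for all $t>0$: $\gamma_0(k+t)^{p-2}t\le B'(t)\le\Gamma_0(k+t)^{p-2}t$ and $\gamma_0(k+t)^{p-2}\le B''(t)\le\Gamma_0(k+t)^{p-2}$. (iv) $H\in C^{3,\beta_0}_{loc}(\mathbb R^n\setminus\{0\})$ is even and $H(\xi)>0$ for all $\xi\ne0$ (and $H(0)=0$). (v) $H(t\xi)=tH(\xi)$ for all $\xi\in\mathbb R^n\setminus\{0\}$ and $t>0$. (vi) The set $\{H<1\}$ is uniformly convex: there is $\lambda>0$ with $\langle D^2H(\xi)v,v\rangle\ge\lambda|v|^2$ for all $\xi$ with $H(\xi)=1$ and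 all $v\in\nabla H(\xi)^\perp$. (vii) $f$ is a positive continuous function on $[0,\infty)$, locally Lipschitz continuous on $(0,\infty)$. (viii) There exist $\delta>0$ and $g\in C^0([0,+\infty))$, non-decreasing on $(0,\delta)$, with $g(0)=0$, $f+g\ge0$, and either $g=0$ on $[0,d]$ for some $d>0$, or $\int_0^\delta\frac{ds}{L^{-1}(G(s))}=+\infty$, where $G(s)=\int_0^s g(t)\,dt$ and $L(s)=sB'(s)-B(s)$. Weak solution: $\int_\Omega B'(H(\nabla u))\langle\nabla H(\nabla u),\nabla\psi\rangle\,dx=\int_\Omega f(u)\psi\,dx$ for all $\psi\in C^1_c(\Omega)$, where $B'(H(\nabla u))\nabla H(\nabla u)$ is understood to be $0$ where $\nabla u=0$. Interior sphere condition at $y\in\partial\Omega$: there is an open Euclidean ball $D\subset\Omega$ with $y\in\partial D$. *)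

theory Defs
  imports "HOL-Analysis.Analysis"
begin

section \<open>Function spaces\<close>

text \<open>On an open set \<open>U\<close>: \<open>C\<^sup>k(U)\<close> and \<open>C\<^sup>k\<^sup>,\<^sup>\<beta>(U)\<close> (the latter locally, that is, on compact
  subsets) are given by iterated partial derivatives. On \<open>real\<close> the only basis vector is \<open>1\<close>,
  so the partial derivative is the ordinary one.\<close>

primrec Ck_on :: "nat \<Rightarrow> 'a::euclidean_space set \<Rightarrow> ('a \<Rightarrow> real) \<Rightarrow> bool" where
  "Ck_on 0 U f \<longleftrightarrow> continuous_on U f"
| "Ck_on (Suc k) U f \<longleftrightarrow>
     (\<forall>x\<in>U. f differentiable (at x)) \<and>
     (\<forall>b\<in>Basis. Ck_on k U (\<lambda>x. frechet_derivative f (at x) b))"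

definition locally_Holder_on :: "real \<Rightarrow> 'a::euclidean_space set \<Rightarrow> ('a \<Rightarrow> real) \<Rightarrow> bool" where
  "locally_Holder_on \<beta> U f \<longleftrightarrow>
     (\<forall>K. compact K \<and> K \<subseteq> U \<longrightarrow>
        (\<exists>C. \<forall>x\<in>K. \<forall>y\<in>K. \<bar>f x - f y\<bar> \<le> C * dist x y powr \<beta>))"

primrec Ck_Holder_loc_on ::
  "nat \<Rightarrow> real \<Rightarrow> 'a::euclidean_space set \<Rightarrow> ('a \<Rightarrow> real) \<Rightarrow> bool" where
  "Ck_Holder_loc_on 0 \<beta> U f \<longleftrightarrow> locally_Holder_on \<beta> U f"
| "Ck_Holder_loc_on (Suc k) \<beta> U f \<longleftrightarrow>
     (\<forall>x\<in>U. f differentiable (at x)) \<and>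
     (\<forall>b\<in>Basis. Ck_Holder_loc_on k \<beta> U (\<lambda>x. frechet_derivative f (at x) b))"

definition grad :: "('a::euclidean_space \<Rightarrow> real) \<Rightarrow> 'a \<Rightarrow> 'a" where
  "grad f x = (\<Sum>b\<in>Basis. frechet_derivative f (at x) b *\<^sub>R b)"

text \<open>\<open>C\<^sup>1\<close> up to the boundary of an open set: the function and its gradient extend
  continuously to the closure. Only the values of \<open>u\<close> on \<open>closure U\<close> matter.\<close>

definition C1_closure_on :: "'a::euclidean_space set \<Rightarrow> ('a \<Rightarrow> real) \<Rightarrow> bool" where
  "C1_closure_on U u \<longleftrightarrow>
     Ck_on 1 U u \<and> continuous_on (closure U) u \<and>
     (\<exists>V. continuous_on (closure U) V \<and> (\<forall>x\<in>U. V x = grad u x))"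

text \<open>Derivative of a function on \<open>[0,\<infinity>)\<close>; it is one-sided at \<open>0\<close>, so that values at negative
  arguments play no role.\<close>

definition deriv_ge0 :: "(real \<Rightarrow> real) \<Rightarrow> real \<Rightarrow> real" where
  "deriv_ge0 B t = vector_derivative B (at t within {0..})"

definition C1_ge0 :: "(real \<Rightarrow> real) \<Rightarrow> bool" where
  "C1_ge0 B \<longleftrightarrow> B differentiable_on {0..} \<and> continuous_on {0..} (deriv_ge0 B)"

section \<open>Domains\<close>

text \<open>Near each boundary point the domain is, in the direction of some unit vector \<open>e\<close>, the
  part above the graph of a \<open>C\<^sup>\<infinity>\<close> function. A function of the coordinates orthogonal to \<open>e\<close>
  is encoded as a function on the whole space that is constant along \<open>e\<close>.\<close>

definition smooth_boundary :: "'a::euclidean_space set \<Rightarrow> bool" where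
  "smooth_boundary \<Omega> \<longleftrightarrow>
     (\<forall>x\<in>frontier \<Omega>. \<exists>r>0. \<exists>e \<phi>.
        norm e = 1 \<and> (\<forall>k. Ck_on k UNIV \<phi>) \<and> (\<forall>z t. \<phi> (z + t *\<^sub>R e) = \<phi> z) \<and>
        \<Omega> \<inter> ball x r = {z \<in> ball x r. \<phi> z < z \<bullet> e})"

definition smooth_bounded_domain :: "'a::euclidean_space set \<Rightarrow> bool" where
  "smooth_bounded_domain \<Omega> \<longleftrightarrow>
     open \<Omega> \<and> connected \<Omega> \<and> \<Omega> \<noteq> {} \<and> bounded \<Omega> \<and> smooth_boundary \<Omega>"

definition interior_sphere_condition :: "'a::euclidean_space set \<Rightarrow> 'a \<Rightarrow> bool" where
  "interior_sphere_condition \<Omega> y \<longleftrightarrow>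
     (\<exists>c r. 0 < r \<and> ball c r \<subseteq> \<Omega> \<and> y \<in> frontier (ball c r))"

text \<open>Velocities at \<open>y\<close> of curves that lie in \<open>S\<close>.\<close>

definition tangent_vectors :: "'a::euclidean_space set \<Rightarrow> 'a \<Rightarrow> 'a set" where
  "tangent_vectors S y =
     {v. \<exists>c \<epsilon>. 0 < \<epsilon> \<and> c 0 = y \<and> (\<forall>t\<in>{-\<epsilon><..<\<epsilon>}. c t \<in> S) \<and>
           (c has_vector_derivative v) (at (0::real))}"

definition inner_unit_normal :: "'a::euclidean_space set \<Rightarrow> 'a \<Rightarrow> 'a \<Rightarrow> bool" where
  "inner_unit_normal \<Omega> y \<nu> \<longleftrightarrow>
     norm \<nu> = 1 \<and> (\<forall>v\<in>tangent_vectors (frontier \<Omega>) y. \<nu> \<bullet> v = 0) \<and>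
     (\<exists>\<epsilon>>0. \<forall>t\<in>{0<..<\<epsilon>}. y + t *\<^sub>R \<nu> \<in> \<Omega>)"

section \<open>The equation\<close>

text \<open>The field \<open>B'(H(\<xi>)) \<nabla>H(\<xi>)\<close>, extended by \<open>0\<close> to \<open>\<xi> = 0\<close>, where \<open>H\<close> is not differentiable.\<close>

definition flux :: "(real \<Rightarrow> real) \<Rightarrow> ('a::euclidean_space \<Rightarrow> real) \<Rightarrow> 'a \<Rightarrow> 'a" where
  "flux B H \<xi> = (if \<xi> = 0 then 0 else deriv_ge0 B (H \<xi>) *\<^sub>R grad H \<xi>)"

definition C1_compact_support :: "'a::euclidean_space set \<Rightarrow> ('a \<Rightarrow> real) \<Rightarrow> bool" where
  "C1_compact_support \<Omega> \<psi> \<longleftrightarrow>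
     Ck_on 1 UNIV \<psi> \<and> compact (closure {x. \<psi> x \<noteq> 0}) \<and> closure {x. \<psi> x \<noteq> 0} \<subseteq> \<Omega>"

definition weak_solution ::
  "(real \<Rightarrow> real) \<Rightarrow> ('a::euclidean_space \<Rightarrow> real) \<Rightarrow> (real \<Rightarrow> real) \<Rightarrow> 'a set \<Rightarrow> ('a \<Rightarrow> real) \<Rightarrow> bool"
where
  "weak_solution B H f \<Omega> u \<longleftrightarrow>
     (\<forall>\<psi>. C1_compact_support \<Omega> \<psi> \<longrightarrow>
        (LINT x:\<Omega>|lborel. flux B H (grad u x) \<bullet> grad \<psi> x) = (LINT x:\<Omega>|lborel. f (u x) * \<psi> x))"

text \<open>The dichotomy on \<open>g\<close>. The reciprocal is taken in \<open>ennreal\<close>, where \<open>1 / 0 = \<infinity>\<close>.\<close>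

definition L_fun :: "(real \<Rightarrow> real) \<Rightarrow> real \<Rightarrow> real" where
  "L_fun B s = s * deriv_ge0 B s - B s"

definition zero_or_divergent :: "(real \<Rightarrow> real) \<Rightarrow> (real \<Rightarrow> real) \<Rightarrow> real \<Rightarrow> bool" where
  "zero_or_divergent B g \<delta> \<longleftrightarrow>
     (\<exists>d>0. \<forall>s\<in>{0..d}. g s = 0) \<or>
     (\<integral>\<^sup>+s\<in>{0<..<\<delta>}. 1 / ennreal (the_inv_into {0..} (L_fun B) (integral {0..s} g)) \<partial>lborel) = \<infinity>"

end

theory Submission
  imports Defs
begin

text \<open>Since \<open>f > 0\<close> on the compact range of \<open>u\<close>, we have \<open>f(u) \<ge> m > 0\<close>, so \<open>u\<close> is a \<^emph>\<open>strict\<close>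
  supersolution and no exponential barrier is needed. On the annulus \<open>r/2 < |x - c| < r\<close> of an
  interior ball touching \<open>y\<close> compare \<open>u\<close> with \<open>v = \<sigma>/2 (r\<^sup>2 - |x - c|\<^sup>2)\<close>. The growth conditions
  give \<open>t B''(t) \<le> M B'(t) \<rightarrow> 0\<close> as \<open>t \<rightarrow> 0\<close>, and with the homogeneity of \<open>H\<close> this makes the divergence
  of the flux of \<open>\<nabla>v\<close> uniformly small for small \<open>\<sigma>\<close>, hence \<open>> -m\<close>. If \<open>v > u + \<epsilon>\<close> somewhere, test
  with the \<open>C\<^sup>1\<close> function \<open>((v - u - \<epsilon>)\<^sup>+)\<^sup>2\<close>: monotonicity of the flux contradicts strictness.
  So \<open>u \<ge> v\<close>, and \<open>v\<close> has inner normal derivative \<open>\<sigma> r > 0\<close> at \<open>y\<close>.\<close>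

section \<open>Gradients and regularity classes\<close>

lemma has_derivative_grad:
  fixes f :: "'a::euclidean_space \<Rightarrow> real"
  assumes "f differentiable (at x)"
  shows "(f has_derivative (\<lambda>h. grad f x \<bullet> h)) (at x)"
proof -
  let ?D = "frechet_derivative f (at x)"
  have D: "(f has_derivative ?D) (at x)"
    using assms frechet_derivative_works by blast
  have "grad f x \<bullet> h = ?D h" for h
  proof -
    have "?D h = ?D (\<Sum>b\<in>Basis. (h \<bullet> b) *\<^sub>R b)"
      by (simp add: euclidean_representation)
    also have "\<dots> = (\<Sum>b\<in>Basis. (h \<bullet> b) *\<^sub>R ?D b)"
      using has_derivative_linear[OF D] by (simp add: linear_sum linear_scale)
    finally show ?thesis
      by (simp add: grad_def inner_sum_left inner_commute[of h] mult.commute)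
  qed
  then show ?thesis
    using D by presburger
qed

lemma grad_eqI:
  fixes f :: "'a::euclidean_space \<Rightarrow> real"
  assumes "(f has_derivative (\<lambda>h. g \<bullet> h)) (at x)"
  shows "grad f x = g"
  by (simp add: grad_def frechet_derivative_at[OF assms, symmetric] euclidean_representation)

lemma Ck_on_1D:
  assumes "Ck_on 1 U f"
  shows "x \<in> U \<Longrightarrow> f differentiable (at x)" "continuous_on U (grad f)"
  using assms unfolding grad_def by (auto simp: One_nat_def intro!: continuous_intros)

lemma Ck_on_1I:
  assumes "\<And>x. x \<in> U \<Longrightarrow> (f has_derivative (\<lambda>h. g x \<bullet> h)) (at x)" "continuous_on U g"
  shows "Ck_on 1 U f"
proof -
  have "frechet_derivative f (at x) b = g x \<bullet> b" if "x \<in> U" for x b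
    using frechet_derivative_at[OF assms(1)[OF that]] by metis
  then have "continuous_on U (\<lambda>x. frechet_derivative f (at x) b)" for b
    using assms(2) by (simp add: continuous_on_inner cong: continuous_on_cong)
  then show ?thesis
    using assms(1) by (auto simp: One_nat_def differentiable_def)
qed

text \<open>A point t > 0 is interior to \<open>{0..}\<close>, so the filter restricted to the
  half-line is the full neighbourhood filter there.\<close>

lemma deriv_ge0_eqI:
  assumes "t > 0" "(B has_real_derivative d) (at t)"
  shows "deriv_ge0 B t = d"
proof -
  have "at t within {0..} = at t"
    using assms(1) by (intro at_within_interior) simp
  then show ?thesis
    using assms(2) by (simp add: deriv_ge0_def has_real_derivative_iff_has_vector_derivative
        vector_derivative_at)
qed

lemma frechet_derivative_real_eq_deriv_ge0:
  assumes "t > 0" "B differentiable (at t)"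
  shows "frechet_derivative B (at t) 1 = deriv_ge0 B t"
proof -
  obtain d where d: "(B has_real_derivative d) (at t)"
    using assms(2) real_differentiable_def by blast
  then have "frechet_derivative B (at t) = (*) d"
    using frechet_derivative_at[of B "(*) d" t] by (simp add: has_field_derivative_def)
  then show ?thesis using deriv_ge0_eqI[OF assms(1) d] by simp
qed

text \<open>The regularity class is phrased through iterated Frechet derivatives, the structure
  conditions on \<open>B\<close> through \<open>deriv_ge0\<close>; the two agree for t > 0.
  Continuity of the second derivative is read off from its differentiability.\<close>

lemma Ck_Holder_loc_on_3_deriv_ge0:
  assumes "Ck_Holder_loc_on 3 \<beta> {0<..} B"
  shows "\<And>t. t > 0 \<Longrightarrow> (deriv_ge0 B has_real_derivative deriv_ge0 (deriv_ge0 B) t) (at t)"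
    and "continuous_on {0<..} (deriv_ge0 (deriv_ge0 B))"
proof -
  define B1 where "B1 t = frechet_derivative B (at t) 1" for t
  define B2 where "B2 t = frechet_derivative B1 (at t) 1" for t
  have diff: "\<And>t. t > 0 \<Longrightarrow> B differentiable (at t)" "\<And>t. t > 0 \<Longrightarrow> B1 differentiable (at t)"
    "\<And>t. t > 0 \<Longrightarrow> B2 differentiable (at t)"
    using assms unfolding B2_def B1_def by (simp_all add: numeral_3_eq_3)
  have B1: "deriv_ge0 B t = B1 t" if "t > 0" for t
    using frechet_derivative_real_eq_deriv_ge0[OF that diff(1)[OF that]] by (simp add: B1_def)
  have der: "(deriv_ge0 B has_real_derivative B2 t) (at t)" if t: "t > 0" for t
  proof -
    obtain d where d: "(B1 has_real_derivative d) (at t)"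
      using diff(2)[OF t] real_differentiable_def by blast
    then have "d = B2 t"
      unfolding has_field_derivative_def B2_def by (simp flip: frechet_derivative_at)
    moreover have "(deriv_ge0 B has_real_derivative d) (at t)"
      using d by (rule has_field_derivative_transform_within_open[of _ _ _ "{0<..}"])
        (use t B1 in auto)
    ultimately show ?thesis by simp
  qed
  have B2: "deriv_ge0 (deriv_ge0 B) t = B2 t" if "t > 0" for t
    by (rule deriv_ge0_eqI[OF that der[OF that]])
  show "(deriv_ge0 B has_real_derivative deriv_ge0 (deriv_ge0 B) t) (at t)" if "t > 0" for t
    using der[OF that] B2[OF that] by simp
  have "continuous_on {0<..} B2"
    using diff(3) by (intro continuous_at_imp_continuous_on)
      (auto intro: differentiable_imp_continuous_within)
  then show "continuous_on {0<..} (deriv_ge0 (deriv_ge0 B))"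
    by (subst continuous_on_cong[OF refl, where g=B2]) (auto simp: B2)
qed

text \<open>The class speaks of scalar partial derivatives; here they are reassembled into a
  derivative of the vector field \<open>grad H\<close>. The second partials are continuous because
  they are differentiable.\<close>

lemma Ck_Holder_loc_on_3_grad:
  assumes "Ck_Holder_loc_on 3 \<beta> U H"
  shows "\<And>x. x \<in> U \<Longrightarrow> H differentiable (at x)"
    and "\<And>x. x \<in> U \<Longrightarrow> grad H differentiable (at x)"
    and "\<And>b. b \<in> Basis \<Longrightarrow> continuous_on U (\<lambda>x. frechet_derivative (grad H) (at x) b)"
proof -
  let ?D1 = "\<lambda>c x. frechet_derivative H (at x) c"
  let ?D2 = "\<lambda>c b x. frechet_derivative (?D1 c) (at x) b"
  show "\<And>x. x \<in> U \<Longrightarrow> H differentiable (at x)"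
    using assms by (simp add: numeral_3_eq_3)
  have d1: "?D1 c differentiable (at x)" if "x \<in> U" "c \<in> Basis" for x c
    using assms that by (simp add: numeral_3_eq_3)
  have d2: "?D2 c b differentiable (at x)" if "x \<in> U" "c \<in> Basis" "b \<in> Basis" for x c b
    using assms that by (simp add: numeral_3_eq_3)
  have grad': "(grad H has_derivative (\<lambda>h. \<Sum>c\<in>Basis. ?D2 c h x *\<^sub>R c)) (at x)" if "x \<in> U" for x
    unfolding grad_def[abs_def]
    by (intro has_derivative_sum has_derivative_scaleR_left)
      (use d1[OF that] frechet_derivative_works in blast)
  then show "\<And>x. x \<in> U \<Longrightarrow> grad H differentiable (at x)"
    using differentiable_def by blast
  have eq: "frechet_derivative (grad H) (at x) b = (\<Sum>c\<in>Basis. ?D2 c b x *\<^sub>R c)" if "x \<in> U" for x b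
    using fun_cong[OF frechet_derivative_at[OF grad'[OF that]], of b] by simp
  show "continuous_on U (\<lambda>x. frechet_derivative (grad H) (at x) b)" if "b \<in> Basis" for b
  proof -
    have "continuous_on U (?D2 c b)" if c: "c \<in> Basis" for c
      using d2[OF _ c \<open>b \<in> Basis\<close>]
      by (intro continuous_at_imp_continuous_on) (auto intro: differentiable_imp_continuous_within)
    then have "continuous_on U (\<lambda>x. \<Sum>c\<in>Basis. ?D2 c b x *\<^sub>R c)"
      by (intro continuous_intros) auto
    then show ?thesis
      by (subst continuous_on_cong[OF refl eq]) auto
  qed
qed

section \<open>Integration by parts against compactly supported functions\<close>

lemma integrable_compact_support:
  fixes q :: "'a::euclidean_space \<Rightarrow> real"
  assumes "continuous_on K q" "compact K" "\<And>x. x \<notin> K \<Longrightarrow> q x = 0"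
  shows "integrable lborel q"
proof -
  have "integrable lborel (\<lambda>x. indicator K x *\<^sub>R q x)"
    using assms by (intro borel_integrable_compact)
  moreover have "(\<lambda>x. indicator K x *\<^sub>R q x) = q"
    using assms(3) by (force simp: fun_eq_iff indicator_def)
  ultimately show ?thesis by metis
qed

text \<open>By translation invariance of Lebesgue measure every difference quotient of
  \<open>h\<close> in direction \<open>b\<close> has integral 0; dominated convergence carries this
  to the derivative.\<close>

lemma integral_directional_derivative_eq_0:
  fixes h :: "'a::euclidean_space \<Rightarrow> real"
  assumes D: "\<And>x. (h has_derivative D x) (at x)"
    and cont: "continuous_on UNIV (\<lambda>x. D x b)"
    and K: "compact K" "\<And>x. x \<notin> K \<Longrightarrow> h x = 0"
  shows "integral\<^sup>L lborel (\<lambda>x. D x b) = 0"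
proof -
  \<comment> \<open>\<open>K'\<close> is \<open>K\<close> swept backwards along \<open>b\<close>.
    Off \<open>K'\<close> both x and x + s b avoid \<open>K\<close> for all s in [0,1], so all
    difference quotients used below vanish outside this one compact set.\<close>
  define K' where "K' = (\<lambda>(x, s). x - s *\<^sub>R b) ` (K \<times> {0..1::real})"
  have "compact K'"
    unfolding K'_def
    by (intro compact_continuous_image compact_Times K compact_Icc)
      (auto simp: split_def intro!: continuous_intros)
  have D0: "D x b = 0" if "x \<notin> K" for x
  proof -
    have "(h has_derivative (\<lambda>_. 0)) (at x)"
      by (rule has_derivative_transform_within_open[of "\<lambda>_. 0" _ _ _ "- K"])
        (use that K compact_imp_closed in auto)
    then show ?thesis
      using has_derivative_unique[OF D] by metis
  qed
  obtain M where M: "\<And>x. x \<in> K \<Longrightarrow> \<bar>D x b\<bar> \<le> M" "M \<ge> 0"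
  proof -
    have "bounded ((\<lambda>x. D x b) ` K)"
      by (intro compact_imp_bounded compact_continuous_image K continuous_on_subset[OF cont]) auto
    then obtain M where "\<forall>x\<in>K. \<bar>D x b\<bar> \<le> M"
      by (auto simp: bounded_iff)
    then show ?thesis
      using that[of "max M 0"] by fastforce
  qed
  have M': "\<bar>D x b\<bar> \<le> M" for x
    using M D0 by (cases "x \<in> K") auto
  have line: "((\<lambda>t. h (x + t *\<^sub>R b)) has_real_derivative D (x + t *\<^sub>R b) b) (at t)" for x t
  proof -
    have "((\<lambda>t. h (x + t *\<^sub>R b)) has_derivative (\<lambda>s. D (x + t *\<^sub>R b) (s *\<^sub>R b))) (at t)"
      by (rule has_derivative_compose[OF _ D]) (auto intro!: derivative_eq_intros)
    moreover have "D (x + t *\<^sub>R b) (s *\<^sub>R b) = s * D (x + t *\<^sub>R b) b" for s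
      using linear_scale[OF has_derivative_linear[OF D]] by (metis real_scaleR_def)
    ultimately show ?thesis
      by (simp add: has_field_derivative_def mult_commute_abs)
  qed
  have hcont: "continuous_on UNIV h"
    using D by (meson continuous_at_imp_continuous_on has_derivative_continuous)
  have hint: "integrable lborel h"
    by (rule integrable_compact_support[OF continuous_on_subset[OF hcont] K]) auto
  \<comment> \<open>The step sizes lie in (0,1], the range of s in \<open>K'\<close>.\<close>
  define t :: "nat \<Rightarrow> real" where "t n = 1 / real (Suc n)" for n
  have t: "0 < t n" "t n \<le> 1" for n
    by (auto simp: t_def)
  have t0: "t \<longlonglongrightarrow> 0"
    unfolding t_def by (rule LIMSEQ_Suc[OF lim_1_over_n])
  define q where "q n x = (h (x + t n *\<^sub>R b) - h x) / t n" for n x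
  have q0: "integral\<^sup>L lborel (q n) = 0" for n
  proof -
    have "h \<in> borel_measurable borel"
      using borel_measurable_continuous_onI[OF hcont] .
    then have eq: "integral\<^sup>L lborel (\<lambda>x. h (t n *\<^sub>R b + x)) = integral\<^sup>L lborel h"
      using integral_distr[of "(+) (t n *\<^sub>R b)" lborel borel h]
      by (simp add: lborel_distr_plus)
    have "integrable lborel (\<lambda>x. h (t n *\<^sub>R b + x))"
      using integrable_distr[of "(+) (t n *\<^sub>R b)" lborel borel h] hint
      by (simp add: lborel_distr_plus)
    then show ?thesis
      unfolding q_def using hint eq by (simp add: add.commute)
  qed
  have "(\<lambda>n. integral\<^sup>L lborel (q n)) \<longlonglongrightarrow> integral\<^sup>L lborel (\<lambda>x. D x b)"
  proof (rule integral_dominated_convergence[where w="\<lambda>x. indicator K' x *\<^sub>R M"])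
    show "(\<lambda>x. D x b) \<in> borel_measurable lborel"
      using borel_measurable_continuous_onI[OF cont] by simp
    show "q n \<in> borel_measurable lborel" for n
    proof -
      have "continuous_on UNIV (q n)"
        unfolding q_def using t(1)[of n]
        by (intro continuous_intros continuous_on_compose2[OF hcont]) auto
      then show ?thesis
        using borel_measurable_continuous_onI by auto
    qed
    show "integrable lborel (\<lambda>x. indicator K' x *\<^sub>R M)"
      by (intro borel_integrable_compact \<open>compact K'\<close>) auto
    show "AE x in lborel. (\<lambda>n. q n x) \<longlonglongrightarrow> D x b"
    proof (rule AE_I2)
      fix x
      have "((\<lambda>s. (h (x + s *\<^sub>R b) - h x) / s) \<longlongrightarrow> D x b) (at 0)"
        using line[of x 0] by (simp add: DERIV_def)
      moreover have "filterlim t (at 0) sequentially"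
        using t0 t(1) by (auto simp: filterlim_at less_imp_neq[symmetric] intro!: always_eventually)
      ultimately show "(\<lambda>n. q n x) \<longlonglongrightarrow> D x b"
        unfolding q_def by (rule filterlim_compose)
    qed
    show "AE x in lborel. norm (q n x) \<le> indicator K' x *\<^sub>R M" for n
    proof (rule AE_I2)
      fix x
      show "norm (q n x) \<le> indicator K' x *\<^sub>R M"
      proof (cases "x \<in> K'")
        case True
        \<comment> \<open>The mean value theorem turns the quotient into a value of the derivative,
          which \<open>M\<close> bounds uniformly in n.\<close>
        obtain s where "h (x + t n *\<^sub>R b) - h (x + 0 *\<^sub>R b) = (t n - 0) * D (x + s *\<^sub>R b) b"
          using MVT2[OF t(1)[of n] line] by blast
        then have "q n x = D (x + s *\<^sub>R b) b"
          using t(1)[of n] by (simp add: q_def)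
        then show ?thesis
          using True M' by simp
      next
        case False
        have "x \<notin> K"
        proof
          assume "x \<in> K"
          then have "x - 0 *\<^sub>R b \<in> K'"
            unfolding K'_def by (intro image_eqI[of _ _ "(x, 0)"]) auto
          with False show False by simp
        qed
        moreover have "x + t n *\<^sub>R b \<notin> K"
        proof
          assume "x + t n *\<^sub>R b \<in> K"
          then have "x \<in> K'"
            unfolding K'_def using t[of n] less_imp_le
            by (intro image_eqI[of _ _ "(x + t n *\<^sub>R b, t n)"]) auto
          with False show False by simp
        qed
        ultimately show ?thesis
          using False K by (simp add: q_def)
      qed
    qed
  qed
  then show ?thesis
    using q0 LIMSEQ_unique[OF _ tendsto_const] by simp
qed

text \<open>For each basis vector b the product (F . b) \<psi>, supported in \<open>K\<close>, is
  C^1 on the whole space, so its b-derivative integrates to 0. Summing over b gives the divergence,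
  that is, the trace of \<open>F'\<close>.\<close>

lemma integration_by_parts:
  fixes F :: "'a::euclidean_space \<Rightarrow> 'a" and \<psi> :: "'a \<Rightarrow> real"
  assumes K: "compact K" "K \<subseteq> A" "open A"
    and F: "\<And>x. x \<in> A \<Longrightarrow> (F has_derivative F' x) (at x)"
    and F': "\<And>b. b \<in> Basis \<Longrightarrow> continuous_on A (\<lambda>x. F' x b)"
    and \<psi>: "\<And>x. (\<psi> has_derivative (\<lambda>h. g x \<bullet> h)) (at x)" "continuous_on UNIV g"
    and \<psi>0: "\<And>x. x \<notin> K \<Longrightarrow> \<psi> x = 0" "\<And>x. x \<notin> K \<Longrightarrow> g x = 0"
  shows "integral\<^sup>L lborel (\<lambda>x. F x \<bullet> g x + (\<Sum>b\<in>Basis. F' x b \<bullet> b) * \<psi> x) = 0"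
proof -
  define D where "D b x h = (F x \<bullet> b) * (g x \<bullet> h) + (F' x h \<bullet> b) * \<psi> x" for b x h
  \<comment> \<open>\<open>D\<close> is the product rule; \<open>E\<close> cuts it off outside
    \<open>A\<close>, where \<open>F\<close> and \<open>F'\<close> are unconstrained.\<close>
  define E where "E b x h = (if x \<in> A then D b x h else 0)" for b x h
  have E_K: "E b x h = 0" if "x \<notin> K" for b x h
    using that \<psi>0 by (auto simp: E_def D_def)
  have Fc: "continuous_on A F"
    using F by (meson continuous_at_imp_continuous_on has_derivative_continuous)
  have \<psi>c: "continuous_on UNIV \<psi>"
    using \<psi> by (meson continuous_at_imp_continuous_on has_derivative_continuous)
  \<comment> \<open>The open sets \<open>A\<close> and \<open>- K\<close> cover the space: the
    product rule gives continuity on the first, vanishing on the second.\<close>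
  have UN: "UNIV = A \<union> - K" using K by auto
  have E_cont: "continuous_on UNIV (\<lambda>x. E b x c)" if "c \<in> Basis" for b c
  proof -
    have "continuous_on A (\<lambda>x. D b x c)"
      unfolding D_def
      by (intro continuous_intros Fc F' that continuous_on_subset[OF \<psi>(2) subset_UNIV]
          continuous_on_subset[OF \<psi>c subset_UNIV])
    then have "continuous_on A (\<lambda>x. E b x c)"
      by (simp add: E_def cong: continuous_on_cong)
    moreover have "continuous_on (- K) (\<lambda>x. E b x c)"
      using E_K by (subst continuous_on_cong[OF refl, where g="\<lambda>x. 0"]) auto
    ultimately show ?thesis
      unfolding UN using K compact_imp_closed by (intro continuous_on_open_Un) auto
  qed
  have E_der: "((\<lambda>x. (F x \<bullet> b) * \<psi> x) has_derivative E b x) (at x)" for b x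
  proof (cases "x \<in> A")
    case True
    have "((\<lambda>x. (F x \<bullet> b) * \<psi> x) has_derivative D b x) (at x)"
      unfolding D_def
      by (rule has_derivative_mult[OF has_derivative_inner_left[OF F[OF True]] \<psi>(1)])
    moreover have "E b x = D b x"
      using True by (simp add: E_def fun_eq_iff)
    ultimately show ?thesis by simp
  next
    case False
    then have xK: "x \<in> - K" using K by auto
    have "((\<lambda>x. (F x \<bullet> b) * \<psi> x) has_derivative (\<lambda>h. 0)) (at x)"
      by (rule has_derivative_transform_within_open[of "\<lambda>_. 0" _ _ _ "- K"])
        (use xK K(1) \<psi>0 compact_imp_closed in auto)
    moreover have "E b x = (\<lambda>h. 0)"
      using False by (simp add: E_def fun_eq_iff)
    ultimately show ?thesis by simp
  qed
  have E_int: "integral\<^sup>L lborel (\<lambda>x. E b x b) = 0" if "b \<in> Basis" for b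
    by (rule integral_directional_derivative_eq_0[OF E_der E_cont[OF that] K(1)]) (simp add: \<psi>0)
  have E_integrable: "integrable lborel (\<lambda>x. E b x b)" if "b \<in> Basis" for b
    by (rule integrable_compact_support[OF continuous_on_subset[OF E_cont[OF that]] K(1) E_K]) auto
  have "F x \<bullet> g x + (\<Sum>b\<in>Basis. F' x b \<bullet> b) * \<psi> x = (\<Sum>b\<in>Basis. E b x b)" for x
  proof (cases "x \<in> A")
    case True
    then show ?thesis
      by (simp add: E_def D_def sum.distrib sum_distrib_right euclidean_inner[symmetric])
  next
    case False
    then have "x \<notin> K" using K by auto
    then show ?thesis using \<psi>0 E_K by simp
  qed
  then show ?thesis
    using E_int E_integrable by (simp add: Bochner_Integration.integral_sum)
qed

section \<open>The anisotropic flux\<close>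

text \<open>Collects what the comparison argument uses about \<open>B\<close> and \<open>H\<close>.
  The constant \<open>M\<close> bounds t B''(t) / B'(t), and convexity of {H < 1} appears as a
  nonnegative Hessian in directions tangent to the level set H = 1.\<close>

locale anisotropic_energy =
  fixes B :: "real \<Rightarrow> real" and H :: "'a::euclidean_space \<Rightarrow> real" and M :: real
  assumes B_cont: "continuous_on {0..} (deriv_ge0 B)"
    and B_diff: "t > 0 \<Longrightarrow> (deriv_ge0 B has_real_derivative deriv_ge0 (deriv_ge0 B) t) (at t)"
    and B_cont2: "continuous_on {0<..} (deriv_ge0 (deriv_ge0 B))"
    and B_zero: "deriv_ge0 B 0 = 0"
    and B_pos: "t > 0 \<Longrightarrow> deriv_ge0 B t > 0" "t > 0 \<Longrightarrow> deriv_ge0 (deriv_ge0 B) t > 0"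
    and B_growth: "t > 0 \<Longrightarrow> t * deriv_ge0 (deriv_ge0 B) t \<le> M * deriv_ge0 B t"
    and H_diff: "\<xi> \<noteq> 0 \<Longrightarrow> H differentiable (at \<xi>)"
    and grad_diff: "\<xi> \<noteq> 0 \<Longrightarrow> grad H differentiable (at \<xi>)"
    and hess_cont: "b \<in> Basis \<Longrightarrow> continuous_on (- {0}) (\<lambda>\<xi>. frechet_derivative (grad H) (at \<xi>) b)"
    and H_pos: "\<xi> \<noteq> 0 \<Longrightarrow> H \<xi> > 0" and H_zero: "H 0 = 0"
    and H_hom: "\<xi> \<noteq> 0 \<Longrightarrow> t > 0 \<Longrightarrow> H (t *\<^sub>R \<xi>) = t * H \<xi>"
    and H_convex: "H \<xi> = 1 \<Longrightarrow> grad H \<xi> \<bullet> v = 0 \<Longrightarrow> frechet_derivative (grad H) (at \<xi>) v \<bullet> v \<ge> 0"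
begin

abbreviation hess :: "'a \<Rightarrow> 'a \<Rightarrow> 'a" where
  "hess \<xi> \<equiv> frechet_derivative (grad H) (at \<xi>)"

text \<open>For \<xi> \<noteq> 0 this is the Hessian of B o H at \<xi> applied to h, hence the
  Jacobian of \<open>flux\<close>.\<close>

definition dflux :: "'a \<Rightarrow> 'a \<Rightarrow> 'a" where
  "dflux \<xi> h = (deriv_ge0 (deriv_ge0 B) (H \<xi>) * (grad H \<xi> \<bullet> h)) *\<^sub>R grad H \<xi>
     + deriv_ge0 B (H \<xi>) *\<^sub>R hess \<xi> h"

lemma has_derivative_H: "\<xi> \<noteq> 0 \<Longrightarrow> (H has_derivative (\<lambda>h. grad H \<xi> \<bullet> h)) (at \<xi>)"
  using H_diff has_derivative_grad by blast

lemma has_derivative_grad_H: "\<xi> \<noteq> 0 \<Longrightarrow> (grad H has_derivative hess \<xi>) (at \<xi>)"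
  using grad_diff frechet_derivative_works by blast

lemma continuous_on_H: "continuous_on (- {0}) H"
  by (auto intro!: continuous_at_imp_continuous_on has_derivative_continuous[OF has_derivative_H])

lemma continuous_on_grad_H: "continuous_on (- {0}) (grad H)"
  by (auto intro!: continuous_at_imp_continuous_on has_derivative_continuous[OF has_derivative_grad_H])

section \<open>Homogeneity of \<open>H\<close> and of its first two derivatives\<close>

lemma has_derivative_scale_arg:
  "((\<lambda>x. t *\<^sub>R x) has_derivative (\<lambda>h. t *\<^sub>R h)) (at x)"
  by (auto intro!: derivative_eq_intros)

text \<open>Differentiate H(t x) = t H(x) in x: the factor t cancels, so the gradient is homogeneous
  of degree 0. Differentiating once more makes the Hessian homogeneous of degree -1.\<close>

lemma grad_H_scale:
  assumes "\<xi> \<noteq> 0" "t > 0"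
  shows "grad H (t *\<^sub>R \<xi>) = grad H \<xi>"
proof -
  have "((\<lambda>x. H (t *\<^sub>R x)) has_derivative (\<lambda>h. grad H (t *\<^sub>R \<xi>) \<bullet> (t *\<^sub>R h))) (at \<xi>)"
    by (rule has_derivative_compose[OF has_derivative_scale_arg has_derivative_H]) (use assms in auto)
  then have "((\<lambda>x. t * H x) has_derivative (\<lambda>h. grad H (t *\<^sub>R \<xi>) \<bullet> (t *\<^sub>R h))) (at \<xi>)"
    by (rule has_derivative_transform_within_open[of _ _ _ _ "- {0}"])
      (use assms H_hom in auto)
  moreover have "((\<lambda>x. t * H x) has_derivative (\<lambda>h. t * (grad H \<xi> \<bullet> h))) (at \<xi>)"
    using has_derivative_H[OF assms(1)] by (rule has_derivative_mult_right)
  ultimately have eq: "(\<lambda>h. grad H (t *\<^sub>R \<xi>) \<bullet> (t *\<^sub>R h)) = (\<lambda>h. t * (grad H \<xi> \<bullet> h))"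
    by (rule has_derivative_unique)
  have "grad H (t *\<^sub>R \<xi>) \<bullet> h = grad H \<xi> \<bullet> h" for h
    using fun_cong[OF eq, of h] assms(2) by simp
  then show ?thesis
    using vector_eq_rdot by blast
qed

lemma hess_scale:
  assumes "\<xi> \<noteq> 0" "t > 0"
  shows "t *\<^sub>R hess (t *\<^sub>R \<xi>) h = hess \<xi> h"
proof -
  have nz: "t *\<^sub>R \<xi> \<noteq> 0" using assms by auto
  have "((\<lambda>x. grad H (t *\<^sub>R x)) has_derivative (\<lambda>h. hess (t *\<^sub>R \<xi>) (t *\<^sub>R h))) (at \<xi>)"
    by (rule has_derivative_compose[OF has_derivative_scale_arg has_derivative_grad_H[OF nz]])
  then have "(grad H has_derivative (\<lambda>h. hess (t *\<^sub>R \<xi>) (t *\<^sub>R h))) (at \<xi>)"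
    by (rule has_derivative_transform_within_open[of _ _ _ _ "- {0}"])
      (use assms grad_H_scale in auto)
  then have "(\<lambda>h. hess (t *\<^sub>R \<xi>) (t *\<^sub>R h)) = hess \<xi>"
    using has_derivative_grad_H[OF assms(1)] has_derivative_unique by blast
  moreover have "hess (t *\<^sub>R \<xi>) (t *\<^sub>R h) = t *\<^sub>R hess (t *\<^sub>R \<xi>) h"
    using linear_scale[OF has_derivative_linear[OF has_derivative_grad_H[OF nz]]] .
  ultimately show ?thesis by metis
qed

text \<open>Euler's identity: differentiate H(t \<xi>) = t H(\<xi>) in t at t = 1.\<close>

lemma euler_H:
  assumes "\<xi> \<noteq> 0"
  shows "grad H \<xi> \<bullet> \<xi> = H \<xi>"
proof -
  have "((\<lambda>t::real. H (t *\<^sub>R \<xi>)) has_derivative (\<lambda>s. grad H (1 *\<^sub>R \<xi>) \<bullet> (s *\<^sub>R \<xi>))) (at 1)"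
    by (rule has_derivative_compose[OF _ has_derivative_H])
      (use assms in \<open>auto intro!: derivative_eq_intros\<close>)
  then have "((\<lambda>t::real. t * H \<xi>) has_derivative (\<lambda>s. grad H (1 *\<^sub>R \<xi>) \<bullet> (s *\<^sub>R \<xi>))) (at 1)"
    by (rule has_derivative_transform_within_open[of _ _ _ _ "{0<..}"])
      (use assms H_hom in auto)
  moreover have "((\<lambda>t::real. t * H \<xi>) has_derivative (\<lambda>s. s * H \<xi>)) (at 1)"
    by (auto intro!: derivative_eq_intros)
  ultimately have "(\<lambda>s. grad H (1 *\<^sub>R \<xi>) \<bullet> (s *\<^sub>R \<xi>)) = (\<lambda>s. s * H \<xi>)"
    by (rule has_derivative_unique)
  from fun_cong[OF this, of 1] show ?thesis by simp
qed

text \<open>The gradient is constant along rays, so its derivative in the radial direction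
  vanishes.\<close>

lemma hess_radial:
  assumes "\<xi> \<noteq> 0"
  shows "hess \<xi> \<xi> = 0"
proof -
  have "((\<lambda>t::real. grad H (t *\<^sub>R \<xi>)) has_derivative (\<lambda>s. hess (1 *\<^sub>R \<xi>) (s *\<^sub>R \<xi>))) (at 1)"
    by (rule has_derivative_compose[OF _ has_derivative_grad_H])
      (use assms in \<open>auto intro!: derivative_eq_intros\<close>)
  then have "((\<lambda>t::real. grad H \<xi>) has_derivative (\<lambda>s. hess (1 *\<^sub>R \<xi>) (s *\<^sub>R \<xi>))) (at 1)"
    by (rule has_derivative_transform_within_open[of _ _ _ _ "{0<..}"])
      (use assms grad_H_scale in auto)
  then have "(\<lambda>s::real. hess (1 *\<^sub>R \<xi>) (s *\<^sub>R \<xi>)) = (\<lambda>s. 0)"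
    by (rule has_derivative_unique) auto
  from fun_cong[OF this, of 1] show ?thesis by simp
qed

text \<open>Differentiating Euler's identity produces the gradient on both sides, and only the
  Hessian term survives. This takes the place of combining \<open>hess_radial\<close> with symmetry
  of the Hessian.\<close>

lemma hess_inner_radial:
  assumes "\<xi> \<noteq> 0"
  shows "hess \<xi> v \<bullet> \<xi> = 0"
proof -
  have "((\<lambda>x. grad H x \<bullet> x) has_derivative (\<lambda>h. grad H \<xi> \<bullet> h + hess \<xi> h \<bullet> \<xi>)) (at \<xi>)"
    by (rule has_derivative_inner[OF has_derivative_grad_H[OF assms] has_derivative_ident])
  then have "(H has_derivative (\<lambda>h. grad H \<xi> \<bullet> h + hess \<xi> h \<bullet> \<xi>)) (at \<xi>)"
    by (rule has_derivative_transform_within_open[of _ _ _ _ "- {0}"])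
      (use assms euler_H in auto)
  then have "(\<lambda>h. grad H \<xi> \<bullet> h + hess \<xi> h \<bullet> \<xi>) = (\<lambda>h. grad H \<xi> \<bullet> h)"
    using has_derivative_H[OF assms] has_derivative_unique by blast
  from fun_cong[OF this, of v] show ?thesis by simp
qed

text \<open>The convexity assumption covers tangent directions on the level set H = 1. Scaling moves
  \<xi> to that level set, and the radial component of v contributes nothing on either side of the
  quadratic form.\<close>

lemma hess_nonneg:
  assumes "\<xi> \<noteq> 0"
  shows "hess \<xi> v \<bullet> v \<ge> 0"
proof -
  define t where "t = inverse (H \<xi>)"
  define \<eta> where "\<eta> = t *\<^sub>R \<xi>"
  \<comment> \<open>Since grad H \<eta> . \<eta> = H \<eta> = 1, subtracting this multiple of \<eta>
    makes w tangent to the level set.\<close>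
  define w where "w = v - (grad H \<eta> \<bullet> v) *\<^sub>R \<eta>"
  have t: "t > 0" using H_pos[OF assms] by (simp add: t_def)
  have \<eta>: "\<eta> \<noteq> 0" using t assms by (simp add: \<eta>_def)
  have H1: "H \<eta> = 1" using H_hom[OF assms t] H_pos[OF assms] by (simp add: \<eta>_def t_def)
  have lin: "linear (hess \<eta>)"
    using has_derivative_grad_H[OF \<eta>] has_derivative_linear by blast
  have "grad H \<eta> \<bullet> w = 0"
    using euler_H[OF \<eta>] H1 by (simp add: w_def inner_diff_right)
  then have "0 \<le> hess \<eta> w \<bullet> w" using H_convex[OF H1] by simp
  also have "hess \<eta> w = hess \<eta> v"
    using hess_radial[OF \<eta>] by (simp add: w_def linear_diff[OF lin] linear_scale[OF lin])
  also have "hess \<eta> v \<bullet> w = hess \<eta> v \<bullet> v"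
    using hess_inner_radial[OF \<eta>] by (simp add: w_def inner_diff_right)
  finally have "0 \<le> t * (hess \<eta> v \<bullet> v)" using t by simp
  also have "\<dots> = hess \<xi> v \<bullet> v"
    using hess_scale[OF assms t, of v] unfolding \<eta>_def by (metis inner_scaleR_left)
  finally show ?thesis .
qed

section \<open>The Jacobian of the flux away from the origin\<close>

lemma has_derivative_flux:
  assumes "\<xi> \<noteq> 0"
  shows "(flux B H has_derivative dflux \<xi>) (at \<xi>)"
proof -
  have "((\<lambda>x. deriv_ge0 B (H x)) has_derivative
      (\<lambda>h. deriv_ge0 (deriv_ge0 B) (H \<xi>) * (grad H \<xi> \<bullet> h))) (at \<xi>)"
    using has_derivative_compose[OF has_derivative_H[OF assms]
        B_diff[OF H_pos[OF assms], unfolded has_field_derivative_def]] .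
  from has_derivative_scaleR[OF this has_derivative_grad_H[OF assms]]
  have "((\<lambda>x. deriv_ge0 B (H x) *\<^sub>R grad H x) has_derivative dflux \<xi>) (at \<xi>)"
    by (simp add: dflux_def[abs_def] add.commute)
  then show ?thesis
    by (rule has_derivative_transform_within_open[of _ _ _ _ "- {0}"])
      (use assms in \<open>auto simp: flux_def\<close>)
qed

lemma dflux_nonneg:
  assumes "\<xi> \<noteq> 0"
  shows "dflux \<xi> v \<bullet> v \<ge> 0"
proof -
  have "dflux \<xi> v \<bullet> v = deriv_ge0 (deriv_ge0 B) (H \<xi>) * (grad H \<xi> \<bullet> v)\<^sup>2
      + deriv_ge0 B (H \<xi>) * (hess \<xi> v \<bullet> v)"
    by (simp add: dflux_def inner_add_left power2_eq_square)
  then show ?thesis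
    using hess_nonneg[OF assms, of v] B_pos[OF H_pos[OF assms]] by simp
qed

lemma continuous_on_dflux:
  assumes "b \<in> Basis"
  shows "continuous_on (- {0}) (\<lambda>\<xi>. dflux \<xi> b)"
proof -
  have HS: "H ` (- {0}) \<subseteq> {0<..}" using H_pos by auto
  have 1: "continuous_on (- {0}) (\<lambda>\<xi>. deriv_ge0 (deriv_ge0 B) (H \<xi>))"
    using continuous_on_compose2[OF B_cont2 continuous_on_H HS] .
  have 2: "continuous_on (- {0}) (\<lambda>\<xi>. deriv_ge0 B (H \<xi>))"
    using HS by (intro continuous_on_compose2[OF B_cont continuous_on_H]) auto
  show ?thesis
    unfolding dflux_def
    by (intro continuous_intros 1 2 continuous_on_grad_H hess_cont[OF assms])
qed

section \<open>The flux near the origin, its monotonicity, and a trace estimate\<close>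

lemma norm_sgn_decomposition:
  assumes "\<xi> \<noteq> 0"
  shows "\<xi> = norm \<xi> *\<^sub>R sgn \<xi>" "sgn \<xi> \<in> sphere 0 1" "norm \<xi> > 0" "sgn \<xi> \<noteq> 0"
  using assms by (auto simp: sgn_div_norm)

text \<open>Both functions are bounded on the compact unit sphere; homogeneity of degree 1 and 0
  spreads the bounds to all \<xi>.\<close>

lemma bounded_H_grad_H:
  obtains C where "C \<ge> 0" "\<And>\<xi>. H \<xi> \<le> C * norm \<xi>" "\<And>\<xi>. \<xi> \<noteq> 0 \<Longrightarrow> norm (grad H \<xi>) \<le> C"
proof -
  have "compact (sphere (0::'a) 1)" "sphere (0::'a) 1 \<subseteq> - {0}" by auto
  then have "bounded (H ` sphere 0 1)" "bounded (grad H ` sphere 0 1)"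
    by (meson compact_continuous_image compact_imp_bounded continuous_on_H continuous_on_grad_H
        continuous_on_subset)+
  then obtain C1 C2 where C1: "\<And>\<xi>. \<xi> \<in> sphere 0 1 \<Longrightarrow> \<bar>H \<xi>\<bar> \<le> C1"
    and C2: "\<And>\<xi>. \<xi> \<in> sphere 0 1 \<Longrightarrow> norm (grad H \<xi>) \<le> C2"
    unfolding bounded_iff by fastforce
  define C where "C = max 0 (max C1 C2)"
  have "H \<xi> \<le> C * norm \<xi>" for \<xi>
  proof (cases "\<xi> = 0")
    case False
    note s = norm_sgn_decomposition[OF False]
    have "H \<xi> = norm \<xi> * H (sgn \<xi>)"
      using H_hom[OF s(4,3)] s(1) by simp
    moreover have "H (sgn \<xi>) \<le> C" using C1[OF s(2)] by (simp add: C_def)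
    ultimately show ?thesis
      by (metis mult.commute mult_left_mono norm_ge_zero)
  qed (simp add: H_zero)
  moreover have "norm (grad H \<xi>) \<le> C" if "\<xi> \<noteq> 0" for \<xi>
  proof -
    note s = norm_sgn_decomposition[OF that]
    have "grad H \<xi> = grad H (sgn \<xi>)"
      using grad_H_scale[OF s(4,3)] s(1) by simp
    then show ?thesis using C2[OF s(2)] by (simp add: C_def)
  qed
  ultimately show ?thesis using that[of C] by (simp add: C_def)
qed

lemma deriv_B_small:
  assumes "\<epsilon> > 0"
  obtains \<tau> where "\<tau> > 0" "\<And>t. 0 \<le> t \<Longrightarrow> t < \<tau> \<Longrightarrow> 0 \<le> deriv_ge0 B t \<and> deriv_ge0 B t < \<epsilon>"
proof -
  obtain \<tau> where \<tau>: "\<tau> > 0" "\<And>t. t \<in> {0..} \<Longrightarrow> dist t 0 < \<tau> \<Longrightarrow> dist (deriv_ge0 B t) (deriv_ge0 B 0) < \<epsilon>"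
    using B_cont assms unfolding continuous_on_iff by (metis atLeast_iff order_refl)
  show ?thesis
  proof (rule that[OF \<tau>(1)])
    fix t :: real assume "0 \<le> t" "t < \<tau>"
    then show "0 \<le> deriv_ge0 B t \<and> deriv_ge0 B t < \<epsilon>"
      using \<tau>(2)[of t] B_zero B_pos(1)[of t] by (cases "t = 0") (auto simp: dist_real_def assms)
  qed
qed

text \<open>At the origin \<open>grad H\<close> need not have a limit but stays bounded, while the
  factor B'(H(\<xi>)) tends to 0; hence the value 0 there is the continuous extension.\<close>

lemma continuous_flux: "continuous_on UNIV (flux B H)"
proof (rule continuous_at_imp_continuous_on, rule ballI)
  fix \<xi> :: 'a
  show "continuous (at \<xi>) (flux B H)"
  proof (cases "\<xi> = 0")
    case False
    then show ?thesis
      using has_derivative_flux has_derivative_continuous by blast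
  next
    case True
    obtain C where C: "C \<ge> 0" "\<And>\<xi>. H \<xi> \<le> C * norm \<xi>" "\<And>\<xi>. \<xi> \<noteq> 0 \<Longrightarrow> norm (grad H \<xi>) \<le> C"
      by (rule bounded_H_grad_H) blast
    have "\<exists>d>0. \<forall>x. dist x 0 < d \<longrightarrow> dist (flux B H x) (flux B H 0) < e" if e: "e > 0" for e
    proof -
      \<comment> \<open>Using C + 1 keeps the denominator positive when C = 0 and makes the final
        bound e C / (C + 1) strictly less than e.\<close>
      have e': "e / (C + 1) > 0" using e C(1) by simp
      obtain \<tau> where \<tau>: "\<tau> > 0" "\<And>t. 0 \<le> t \<Longrightarrow> t < \<tau> \<Longrightarrow> 0 \<le> deriv_ge0 B t \<and> deriv_ge0 B t < e / (C + 1)"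
        by (rule deriv_B_small[OF e']) blast
      have "norm (flux B H x) < e" if x: "norm x < \<tau> / (C + 1)" for x
      proof (cases "x = 0")
        case False
        have "H x \<le> C * norm x" by (rule C)
        also have "\<dots> \<le> (C + 1) * norm x" by (simp add: mult_right_mono)
        also have "\<dots> < \<tau>" using x C(1) by (simp add: field_simps)
        finally have b: "0 \<le> deriv_ge0 B (H x)" "deriv_ge0 B (H x) < e / (C + 1)"
          using \<tau>(2)[of "H x"] H_pos[OF False] by auto
        have "norm (flux B H x) = deriv_ge0 B (H x) * norm (grad H x)"
          using False b by (simp add: flux_def)
        also have "\<dots> \<le> e / (C + 1) * C"
          using b C(1) C(3)[OF False] by (intro mult_mono) auto
        also have "\<dots> < e"
          using e C(1) by (simp add: field_simps)
        finally show ?thesis .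
      qed (simp add: flux_def e)
      moreover have "\<tau> / (C + 1) > 0" using \<tau> C by simp
      ultimately show ?thesis
        by (intro exI[of _ "\<tau> / (C + 1)"]) (auto simp: dist_norm flux_def)
    qed
    then show ?thesis
      unfolding True continuous_at_eps_delta by blast
  qed
qed

text \<open>Along a segment the derivative of the tested flux is nonnegative except possibly at
  the one point where the segment meets the origin; there continuity suffices.\<close>

lemma flux_monotone: "(flux B H \<xi> - flux B H \<eta>) \<bullet> (\<xi> - \<eta>) \<ge> 0"
proof -
  define p where "p t = \<eta> + t *\<^sub>R (\<xi> - \<eta>)" for t :: real
  define q where "q t = flux B H (p t) \<bullet> (\<xi> - \<eta>)" for t
  have q_cont: "continuous_on S q" for S
    unfolding q_def p_def
    by (intro continuous_intros continuous_on_compose2[OF continuous_flux]) auto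
  have q_der: "(q has_real_derivative dflux (p t) (\<xi> - \<eta>) \<bullet> (\<xi> - \<eta>)) (at t)" if nz: "p t \<noteq> 0" for t
  proof -
    have p': "(p has_derivative (\<lambda>s. s *\<^sub>R (\<xi> - \<eta>))) (at t)"
      unfolding p_def by (auto intro!: derivative_eq_intros)
    have "(q has_derivative (\<lambda>s. dflux (p t) (s *\<^sub>R (\<xi> - \<eta>)) \<bullet> (\<xi> - \<eta>))) (at t)"
      unfolding q_def
      by (intro has_derivative_inner_left has_derivative_compose[OF p' has_derivative_flux[OF nz]])
    moreover have "dflux (p t) (s *\<^sub>R (\<xi> - \<eta>)) = s *\<^sub>R dflux (p t) (\<xi> - \<eta>)" for s
      using linear_scale[OF has_derivative_linear[OF has_derivative_flux[OF nz]]] .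
    ultimately show ?thesis
      by (simp add: has_field_derivative_def mult_commute_abs)
  qed
  have mono: "q a \<le> q b" if "a \<le> b" "\<And>t. a < t \<Longrightarrow> t < b \<Longrightarrow> p t \<noteq> 0" for a b
  proof (rule DERIV_nonneg_imp_increasing_open[OF that(1) _ q_cont])
    fix t assume "a < t" "t < b"
    then show "\<exists>y. (q has_real_derivative y) (at t) \<and> 0 \<le> y"
      using q_der dflux_nonneg that(2) by blast
  qed
  have "q 0 \<le> q 1"
  proof (cases "\<xi> = \<eta>")
    case True
    then show ?thesis by (simp add: q_def)
  next
    case ne: False
    have uniq: "s = t" if "p s = 0" "p t = 0" for s t
    proof -
      have "(s - t) *\<^sub>R (\<xi> - \<eta>) = 0"
        using that unfolding p_def by (metis (no_types) add_left_cancel cancel_comm_monoid_add_class.diff_cancel scaleR_diff_left)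
      then show ?thesis using ne by simp
    qed
    show ?thesis
    proof (cases "\<exists>s. 0 < s \<and> s < 1 \<and> p s = 0")
      case True
      then obtain s where s: "0 < s" "s < 1" "p s = 0" by blast
      have nz: "p t \<noteq> 0" if "t \<noteq> s" for t
        using uniq s(3) that by blast
      have "q 0 \<le> q s" by (rule mono) (use s nz in auto)
      also have "q s \<le> q 1" by (rule mono) (use s nz in auto)
      finally show ?thesis .
    next
      case False
      then show ?thesis by (intro mono) auto
    qed
  qed
  then show ?thesis
    by (simp add: q_def p_def inner_diff_left)
qed

text \<open>Homogeneity and the growth bound let B'(\<sigma> H(z)) be factored out of the scaled
  trace, leaving a function of z that is bounded on \<open>S\<close>. The factor tends to 0 with
  \<sigma>, uniformly on \<open>S\<close>.\<close>

lemma trace_dflux_scaled_small: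
  assumes S: "compact S" "0 \<notin> S" and m: "m > 0"
  obtains \<sigma>0 where "\<sigma>0 > 0"
    "\<And>\<sigma> z. 0 < \<sigma> \<Longrightarrow> \<sigma> < \<sigma>0 \<Longrightarrow> z \<in> S \<Longrightarrow> \<sigma> * (\<Sum>b\<in>Basis. dflux (\<sigma> *\<^sub>R z) b \<bullet> b) < m"
proof -
  \<comment> \<open>\<open>T\<close> is what remains after factoring out B'(\<sigma> H(z)), with B''
    replaced by its bound in terms of B'.\<close>
  define T where "T z = M * (\<Sum>b\<in>Basis. (grad H z \<bullet> b)\<^sup>2) / H z + (\<Sum>b\<in>Basis. hess z b \<bullet> b)" for z
  have S0: "S \<subseteq> - {0}" using S by auto
  have HS: "\<forall>z\<in>S. H z \<noteq> 0"
    using S(2) H_pos less_imp_neq by metis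
  have "continuous_on S T"
    unfolding T_def
    by (intro continuous_intros continuous_on_subset[OF continuous_on_H S0]
        continuous_on_subset[OF continuous_on_grad_H S0] continuous_on_subset[OF hess_cont S0])
      (use HS in auto)
  then have "bounded (T ` S)"
    using S compact_continuous_image compact_imp_bounded by blast
  then obtain C1 where C1: "\<And>z. z \<in> S \<Longrightarrow> T z \<le> C1"
    using bounded_imp_bdd_above bdd_above_def by (metis imageI)
  have "bounded (H ` S)"
    using S compact_continuous_image compact_imp_bounded continuous_on_subset[OF continuous_on_H S0] by blast
  then obtain C2 where C2: "\<And>z. z \<in> S \<Longrightarrow> H z \<le> C2"
    using bounded_imp_bdd_above bdd_above_def by (metis imageI)
  \<comment> \<open>The 1 makes C positive, so m / C and \<tau> / C are legitimate
    thresholds.\<close>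
  define C where "C = max 1 (max C1 C2)"
  have C: "C > 0" "\<And>z. z \<in> S \<Longrightarrow> T z \<le> C" "\<And>z. z \<in> S \<Longrightarrow> H z \<le> C"
    using C1 C2 by (force simp: C_def)+
  obtain \<tau> where \<tau>: "\<tau> > 0" "\<And>t. 0 \<le> t \<Longrightarrow> t < \<tau> \<Longrightarrow> 0 \<le> deriv_ge0 B t \<and> deriv_ge0 B t < m / C"
    using deriv_B_small[of "m / C"] m C by auto
  show ?thesis
  proof (rule that[of "\<tau> / C"])
    show "\<tau> / C > 0" using \<tau> C by simp
    fix \<sigma> z assume \<sigma>: "0 < \<sigma>" "\<sigma> < \<tau> / C" and z: "z \<in> S"
    have z0: "z \<noteq> 0" using z S by auto
    define h where "h = H z"
    define t where "t = \<sigma> * h"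
    have h: "h > 0" "h \<le> C" using H_pos[OF z0] C(3)[OF z] by (auto simp: h_def)
    have t: "t > 0" "t < \<tau>"
    proof -
      show "t > 0" using \<sigma> h by (simp add: t_def)
      have "t \<le> \<sigma> * C" using \<sigma> h by (simp add: t_def)
      also have "\<dots> < \<tau>" using \<sigma> C by (simp add: field_simps)
      finally show "t < \<tau>" .
    qed
    have b: "0 < deriv_ge0 B t" "deriv_ge0 B t < m / C"
      using \<tau>(2)[of t] t B_pos(1) by auto
    \<comment> \<open>The outer factor \<sigma> is absorbed exactly by the degree -1 homogeneity of
      the Hessian; in the first term it remains, to be paired with B''.\<close>
    have e: "\<sigma> * (dflux (\<sigma> *\<^sub>R z) b \<bullet> b)
        = \<sigma> * deriv_ge0 (deriv_ge0 B) t * (grad H z \<bullet> b)\<^sup>2 + deriv_ge0 B t * (hess z b \<bullet> b)" for b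
    proof -
      have "hess z b \<bullet> b = \<sigma> * (hess (\<sigma> *\<^sub>R z) b \<bullet> b)"
        by (metis hess_scale[OF z0 \<sigma>(1)] inner_scaleR_left)
      then show ?thesis
        by (simp add: dflux_def H_hom[OF z0 \<sigma>(1)] grad_H_scale[OF z0 \<sigma>(1)] h_def t_def
            inner_add_left power2_eq_square algebra_simps)
    qed
    \<comment> \<open>This is the growth bound at t = \<sigma> h, divided by h.\<close>
    have "\<sigma> * deriv_ge0 (deriv_ge0 B) t \<le> deriv_ge0 B t * M / h"
      using B_growth[OF t(1)] h by (simp add: t_def field_simps)
    then have "\<sigma> * (\<Sum>b\<in>Basis. dflux (\<sigma> *\<^sub>R z) b \<bullet> b)
      \<le> (\<Sum>b\<in>Basis. deriv_ge0 B t * M / h * (grad H z \<bullet> b)\<^sup>2 + deriv_ge0 B t * (hess z b \<bullet> b))"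
      unfolding sum_distrib_left e by (intro sum_mono add_right_mono mult_right_mono) auto
    also have "\<dots> = deriv_ge0 B t * T z"
      by (simp add: T_def h_def sum.distrib sum_distrib_left algebra_simps sum_divide_distrib)
    also have "\<dots> \<le> deriv_ge0 B t * C"
      using C(2)[OF z] b by (intro mult_left_mono) auto
    also have "\<dots> < m" using b C by (simp add: field_simps)
    finally show "\<sigma> * (\<Sum>b\<in>Basis. dflux (\<sigma> *\<^sub>R z) b \<bullet> b) < m" .
  qed
qed

end

section \<open>Comparison with a paraboloid\<close>

text \<open>Squaring removes the kink of the positive part at 0, so that the test function built
  from it is C^1.\<close>

lemma has_derivative_square_pos_part:
  "((\<lambda>s::real. (max 0 s)\<^sup>2) has_real_derivative 2 * max 0 s) (at s)"
proof -
  consider "s > 0" | "s < 0" | "s = 0" by linarith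
  then show ?thesis
  proof cases
    case 1
    have "((\<lambda>s::real. s\<^sup>2) has_real_derivative 2 * s) (at s)"
      by (auto intro!: derivative_eq_intros)
    then have "((\<lambda>s::real. (max 0 s)\<^sup>2) has_real_derivative 2 * s) (at s)"
      by (rule has_field_derivative_transform_within_open[of _ _ _ "{0<..}"]) (use 1 in auto)
    then show ?thesis using 1 by simp
  next
    case 2
    have "((\<lambda>s::real. 0) has_real_derivative 0) (at s)"
      by simp
    then have "((\<lambda>s::real. (max 0 s)\<^sup>2) has_real_derivative 0) (at s)"
      by (rule has_field_derivative_transform_within_open[of _ _ _ "{..<0}"]) (use 2 in auto)
    then show ?thesis using 2 by simp
  next
    case 3
    have "((\<lambda>h::real. max 0 h) \<longlongrightarrow> max 0 0) (at 0)"
      by (intro tendsto_intros)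
    \<comment> \<open>At 0 the difference quotient of the squared positive part is the positive part
      itself.\<close>
    moreover have "\<forall>\<^sub>F h in at (0::real). max 0 h = ((max 0 (0 + h))\<^sup>2 - (max 0 0)\<^sup>2) / h"
      by (auto simp: eventually_at_filter power2_eq_square max_def)
    ultimately have "((\<lambda>h::real. ((max 0 (0 + h))\<^sup>2 - (max 0 0)\<^sup>2) / h) \<longlongrightarrow> max 0 0) (at 0)"
      by (rule Lim_transform_eventually)
    then show ?thesis
      by (simp add: DERIV_def 3)
  qed
qed

section \<open>Weak comparison with a strict subsolution\<close>

context anisotropic_energy
begin

text \<open>Here \<open>w\<close> is the gradient of \<open>v\<close>, and the trace of
  \<open>F'\<close> is the divergence of its flux. Combining the weak equation for \<open>u\<close>
  with integration by parts for \<open>v\<close> yields an integral equal to 0 whose integrand is a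
  monotonicity term plus a term that is positive wherever the test function is.\<close>

lemma weak_comparison:
  assumes dom: "open \<Omega>" "open A" "A \<subseteq> \<Omega>" "bounded A"
    and u: "Ck_on 1 \<Omega> u" "continuous_on (closure A) u" "weak_solution B H f \<Omega> u"
      "\<And>x. x \<in> \<Omega> \<Longrightarrow> u x \<ge> 0"
    and f: "continuous_on {0..} f"
    and v: "continuous_on (closure A) v" "\<And>x. x \<in> A \<Longrightarrow> (v has_derivative (\<lambda>h. w x \<bullet> h)) (at x)"
      "continuous_on A w"
    and F: "\<And>x. x \<in> A \<Longrightarrow> ((\<lambda>x. flux B H (w x)) has_derivative F' x) (at x)"
      "\<And>b. b \<in> Basis \<Longrightarrow> continuous_on A (\<lambda>x. F' x b)"
    and sub: "\<And>x. x \<in> A \<Longrightarrow> (\<Sum>b\<in>Basis. F' x b \<bullet> b) + f (u x) > 0"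
    and bdry: "\<And>x. x \<in> frontier A \<Longrightarrow> v x \<le> u x"
    and x: "x \<in> A"
  shows "v x \<le> u x"
proof (rule ccontr)
  assume "\<not> v x \<le> u x"
  \<comment> \<open>Half the assumed excess at x: positive, yet still exceeded at x. The shift by
    \<epsilon> keeps the support of the test function away from the frontier of \<open>A\<close>,
    where v \<le> u.\<close>
  define \<epsilon> where "\<epsilon> = (v x - u x) / 2"
  have \<epsilon>: "\<epsilon> > 0" "v x - u x > \<epsilon>"
    using \<open>\<not> v x \<le> u x\<close> by (auto simp: \<epsilon>_def)
  define K where "K = {z \<in> closure A. \<epsilon> \<le> v z - u z}"
  define s where "s z = max 0 (v z - u z - \<epsilon>)" for z
  define \<psi> where "\<psi> z = (if z \<in> A then (s z)\<^sup>2 else 0)" for z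
  \<comment> \<open>By the chain rule \<open>g\<close> is the gradient of \<open>\<psi>\<close>;
    both are extended by 0 outside \<open>A\<close>.\<close>
  define g where "g z = (if z \<in> A then (2 * s z) *\<^sub>R (w z - grad u z) else 0)" for z
  have vu_cont: "continuous_on (closure A) (\<lambda>z. v z - u z)"
    by (intro continuous_intros u v)
  have "closed K"
    using continuous_closed_preimage[OF vu_cont closed_closure closed_atLeast[of \<epsilon>]]
    by (simp add: K_def vimage_def Collect_conj_eq)
  moreover have "bounded K"
    by (rule bounded_subset[OF bounded_closure[OF dom(4)]]) (auto simp: K_def)
  ultimately have K: "compact K"
    using compact_eq_bounded_closed by blast
  have KA: "K \<subseteq> A"
  proof
    fix z assume z: "z \<in> K"
    then have "z \<notin> frontier A" using bdry[of z] \<epsilon> by (auto simp: K_def)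
    then show "z \<in> A"
      using z dom(2) by (auto simp: K_def frontier_def interior_open)
  qed
  have sK: "s z = 0" if "z \<in> A" "z \<notin> K" for z
    using that closure_subset[of A] by (auto simp: K_def s_def)
  have \<psi>K: "\<psi> z = 0" and gK: "g z = 0" if "z \<notin> K" for z
    using sK that by (auto simp: \<psi>_def g_def)
  have u': "(u has_derivative (\<lambda>h. grad u z \<bullet> h)) (at z)" if "z \<in> A" for z
    using has_derivative_grad Ck_on_1D(1)[OF u(1)] that dom(3) by blast
  have gu: "continuous_on A (grad u)"
    using Ck_on_1D(2)[OF u(1)] dom(3) continuous_on_subset by blast
  have \<psi>': "(\<psi> has_derivative (\<lambda>h. g z \<bullet> h)) (at z)" for z
  proof (cases "z \<in> A")
    case True
    have "((\<lambda>z. v z - u z - \<epsilon>) has_derivative (\<lambda>h. w z \<bullet> h - grad u z \<bullet> h)) (at z)"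
      using v(2)[OF True] u'[OF True] by (auto intro!: derivative_eq_intros)
    from has_derivative_compose[OF this
        has_derivative_square_pos_part[unfolded has_field_derivative_def, of "v z - u z - \<epsilon>"]]
    have "((\<lambda>z. (s z)\<^sup>2) has_derivative (\<lambda>h. 2 * s z * (w z \<bullet> h - grad u z \<bullet> h))) (at z)"
      by (simp add: s_def)
    then have "(\<psi> has_derivative (\<lambda>h. 2 * s z * (w z \<bullet> h - grad u z \<bullet> h))) (at z)"
      by (rule has_derivative_transform_within_open[of _ _ _ _ A]) (use True dom(2) in \<open>auto simp: \<psi>_def\<close>)
    moreover have "(\<lambda>h. 2 * s z * (w z \<bullet> h - grad u z \<bullet> h)) = (\<lambda>h. g z \<bullet> h)"
      using True by (simp add: g_def inner_diff_left)
    ultimately show ?thesis by simp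
  next
    case False
    have zK: "z \<in> - K" using False KA by auto
    have "(\<psi> has_derivative (\<lambda>h. 0)) (at z)"
      by (rule has_derivative_transform_within_open[of "\<lambda>_. 0" _ _ _ "- K"])
        (use zK \<psi>K \<open>closed K\<close> in auto)
    then show ?thesis using False by (simp add: g_def)
  qed
  have s_cont: "continuous_on A s"
    unfolding s_def
    by (intro continuous_intros continuous_on_subset[OF u(2)] continuous_on_subset[OF v(1)] closure_subset)
  have g_cont: "continuous_on UNIV g"
  proof -
    have "continuous_on A (\<lambda>z. (2 * s z) *\<^sub>R (w z - grad u z))"
      by (intro continuous_intros s_cont v gu)
    then have "continuous_on A g"
      by (simp add: g_def cong: continuous_on_cong)
    moreover have "continuous_on (- K) g"
      by (subst continuous_on_cong[OF refl, where g="\<lambda>_. 0"]) (auto simp: gK)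
    moreover have "UNIV = A \<union> - K" using KA by auto
    ultimately show ?thesis
      using dom(2) \<open>closed K\<close> continuous_on_open_Un[of A "- K" g] by auto
  qed
  have \<psi>_cont: "continuous_on UNIV \<psi>"
    using \<psi>' by (meson continuous_at_imp_continuous_on has_derivative_continuous)
  have supp: "closure {z. \<psi> z \<noteq> 0} \<subseteq> K"
    using \<psi>K \<open>closed K\<close> by (intro closure_minimal) auto
  have grad_\<psi>: "grad \<psi> = g"
    using grad_eqI[OF \<psi>'] by blast
  have "C1_compact_support \<Omega> \<psi>"
    unfolding C1_compact_support_def
  proof (intro conjI)
    show "Ck_on 1 UNIV \<psi>" by (rule Ck_on_1I[OF \<psi>' g_cont])
    show "compact (closure {z. \<psi> z \<noteq> 0})"
      using supp K by (meson bounded_subset closed_closure compact_eq_bounded_closed)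
    show "closure {z. \<psi> z \<noteq> 0} \<subseteq> \<Omega>"
      using supp KA dom(3) by blast
  qed
  then have weak: "(LINT z:\<Omega>|lborel. flux B H (grad u z) \<bullet> grad \<psi> z) = (LINT z:\<Omega>|lborel. f (u z) * \<psi> z)"
    using u(3) unfolding weak_solution_def by blast
  \<comment> \<open>\<open>P1\<close> integrates to 0 by parts; \<open>P2\<close> and
    \<open>P3\<close> are the two sides of the weak equation tested with
    \<open>\<psi>\<close>.\<close>
  define P1 where "P1 z = flux B H (w z) \<bullet> g z + (\<Sum>b\<in>Basis. F' z b \<bullet> b) * \<psi> z" for z
  define P2 where "P2 z = flux B H (grad u z) \<bullet> g z" for z
  define P3 where "P3 z = f (u z) * \<psi> z" for z
  have wK: "continuous_on K w" and guK: "continuous_on K (grad u)"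
    using continuous_on_subset[OF v(3) KA] continuous_on_subset[OF gu KA] by auto
  have gcK: "continuous_on K g" and \<psi>cK: "continuous_on K \<psi>"
    using continuous_on_subset[OF g_cont subset_UNIV] continuous_on_subset[OF \<psi>_cont subset_UNIV] by auto
  have F'K: "continuous_on K (\<lambda>x. F' x b)" if "b \<in> Basis" for b
    using continuous_on_subset[OF F(2)[OF that] KA] .
  have cw: "continuous_on K (\<lambda>z. flux B H (w z))"
    by (rule continuous_on_compose2[OF continuous_flux wK]) simp
  have cu: "continuous_on K (\<lambda>z. flux B H (grad u z))"
    by (rule continuous_on_compose2[OF continuous_flux guK]) simp
  have "continuous_on K u"
    using u(2) by (rule continuous_on_subset) (auto simp: K_def)
  then have cf: "continuous_on K (\<lambda>z. f (u z))"
    by (rule continuous_on_compose2[OF f]) (use u(4) KA dom(3) in auto)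
  have int1: "integrable lborel P1"
  proof (rule integrable_compact_support[OF _ K])
    show "continuous_on K P1"
      unfolding P1_def by (intro continuous_intros cw F'K gcK \<psi>cK)
  qed (simp add: P1_def \<psi>K gK)
  have int2: "integrable lborel P2"
  proof (rule integrable_compact_support[OF _ K])
    show "continuous_on K P2"
      unfolding P2_def by (intro continuous_intros cu gcK)
  qed (simp add: P2_def gK)
  have int3: "integrable lborel P3"
  proof (rule integrable_compact_support[OF _ K])
    show "continuous_on K P3"
      unfolding P3_def by (intro continuous_intros cf \<psi>cK)
  qed (simp add: P3_def \<psi>K)
  have i1: "integral\<^sup>L lborel P1 = 0"
    unfolding P1_def by (rule integration_by_parts[OF K KA dom(2) F \<psi>' g_cont \<psi>K gK])
  \<comment> \<open>Both integrands vanish off K \<subseteq> \<Omega>, so the integrals over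
    \<Omega> are integrals over the whole space.\<close>
  have "(\<lambda>z. indicator \<Omega> z *\<^sub>R P2 z) = P2" "(\<lambda>z. indicator \<Omega> z *\<^sub>R P3 z) = P3"
    using KA dom(3) \<psi>K gK by (force simp: fun_eq_iff indicator_def P2_def P3_def)+
  then have i23: "integral\<^sup>L lborel P2 = integral\<^sup>L lborel P3"
    using weak unfolding grad_\<psi> by (simp add: set_lebesgue_integral_def P2_def[symmetric] P3_def[symmetric])
  \<comment> \<open>On \<open>A\<close> this is 2 s times the monotonicity expression of the flux,
    plus (divergence + f(u)) \<psi>.\<close>
  define Q where "Q z = P1 z - P2 z + P3 z" for z
  have Qint: "integrable lborel Q" and Q0: "integral\<^sup>L lborel Q = 0"
    unfolding Q_def using int1 int2 int3 i1 i23 by auto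
  have Qge: "Q z \<ge> ((\<Sum>b\<in>Basis. F' z b \<bullet> b) + f (u z)) * \<psi> z" for z
  proof (cases "z \<in> A")
    case True
    have "0 \<le> 2 * s z * ((flux B H (w z) - flux B H (grad u z)) \<bullet> (w z - grad u z))"
      using flux_monotone by (intro mult_nonneg_nonneg) (auto simp: s_def)
    then show ?thesis
      using True by (simp add: Q_def P1_def P2_def P3_def g_def algebra_simps inner_diff_left)
  next
    case False
    then show ?thesis by (simp add: Q_def P1_def P2_def P3_def g_def \<psi>_def)
  qed
  \<comment> \<open>\<open>Q\<close> is nonnegative with integral 0, hence 0 almost everywhere, but
    positive on the open set \<open>U\<close>. So \<open>U\<close> is null, although it contains
    x.\<close>
  define U where "U = {z \<in> A. v z - u z > \<epsilon>}"
  have Qnn: "Q z \<ge> 0" for z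
  proof (cases "z \<in> A")
    case True
    then have "0 \<le> ((\<Sum>b\<in>Basis. F' z b \<bullet> b) + f (u z)) * \<psi> z"
      using sub[OF True] by (simp add: \<psi>_def)
    then show ?thesis using Qge[of z] by linarith
  next
    case False
    then show ?thesis using Qge[of z] by (simp add: \<psi>_def)
  qed
  have Qpos: "Q z > 0" if "z \<in> U" for z
  proof -
    have "\<psi> z > 0" "z \<in> A" using that by (auto simp: \<psi>_def U_def s_def)
    then have "0 < ((\<Sum>b\<in>Basis. F' z b \<bullet> b) + f (u z)) * \<psi> z"
      using sub by simp
    then show ?thesis using Qge[of z] by linarith
  qed
  have "AE z in lborel. Q z = 0"
    using integral_nonneg_eq_0_iff_AE[OF Qint] Q0 Qnn by simp
  then have "AE z in lborel. z \<notin> U"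
    by eventually_elim (use Qpos in force)
  moreover have "open U"
  proof -
    have "U = A \<inter> (\<lambda>z. v z - u z) -` {\<epsilon><..}" by (auto simp: U_def)
    then show ?thesis
      using continuous_open_preimage[OF continuous_on_subset[OF vu_cont closure_subset] dom(2)] by simp
  qed
  ultimately have "U \<in> null_sets lborel"
    by (subst AE_iff_null_sets) auto
  then have "negligible U"
    by (simp add: negligible_iff_null_sets null_sets_completionI)
  moreover have "x \<in> U" using \<epsilon> x by (simp add: U_def)
  ultimately show False
    using open_not_negligible[OF \<open>open U\<close>] by blast
qed

end

section \<open>The paraboloid barrier on an annulus\<close>

context anisotropic_energy
begin

text \<open>The inner ball is removed because the gradient \<sigma> (c - x) of the barrier vanishes
  at the centre, where the flux may fail to be differentiable. On the annulus c - x ranges in a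
  fixed compact set avoiding 0, so one small \<sigma> serves all points.\<close>

lemma paraboloid_lower_bound:
  assumes ball: "r > 0" "ball c r \<subseteq> \<Omega>" and \<Omega>: "open \<Omega>" "bounded \<Omega>"
    and u: "Ck_on 1 \<Omega> u" "continuous_on (closure \<Omega>) u" "weak_solution B H f \<Omega> u"
      "\<And>x. x \<in> \<Omega> \<Longrightarrow> u x > 0" "\<And>x. x \<in> frontier \<Omega> \<Longrightarrow> u x = 0"
    and f: "continuous_on {0..} f" "\<And>s. s \<ge> 0 \<Longrightarrow> f s > 0"
  obtains \<sigma> where "\<sigma> > 0"
    "\<And>x. r / 2 < dist c x \<Longrightarrow> dist c x < r \<Longrightarrow> \<sigma> / 2 * (r\<^sup>2 - (dist c x)\<^sup>2) \<le> u x"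
proof -
  have u_nn: "u x \<ge> 0" if "x \<in> closure \<Omega>" for x
    using that u(4,5) \<Omega>(1) by (cases "x \<in> \<Omega>") (fastforce simp: frontier_def interior_open)+
  have cball: "cball c r \<subseteq> closure \<Omega>"
    using closure_mono[OF ball(2)] ball(1) by simp
  have "c \<in> \<Omega>" using ball by auto
  have fu: "continuous_on (closure \<Omega>) (\<lambda>x. f (u x))"
    by (rule continuous_on_compose2[OF f(1) u(2)]) (use u_nn in auto)
  have "compact (closure \<Omega>)" "closure \<Omega> \<noteq> {}"
    using \<Omega>(2) \<open>c \<in> \<Omega>\<close> closure_subset by auto
  from continuous_attains_inf[OF this fu] obtain p where p: "p \<in> closure \<Omega>"
    "\<And>x. x \<in> closure \<Omega> \<Longrightarrow> f (u p) \<le> f (u x)" by blast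
  \<comment> \<open>Compactness of the closure makes the minimum of f(u) attained, and
    \<open>f\<close> is positive on all values u \<ge> 0, including the boundary value 0.\<close>
  define m where "m = f (u p)"
  have m: "m > 0" using p(1) u_nn f(2) by (simp add: m_def)
  have "cball c (r/2) \<subseteq> ball c r" using ball(1) by auto
  then have half: "cball c (r/2) \<subseteq> \<Omega>" using ball(2) by blast
  then have "continuous_on (cball c (r/2)) u"
    using u(2) closure_subset continuous_on_subset by (meson order_trans)
  moreover have "cball c (r/2) \<noteq> {}" using ball(1) by simp
  ultimately obtain q where q: "q \<in> cball c (r/2)" "\<And>x. x \<in> cball c (r/2) \<Longrightarrow> u q \<le> u x"
    using continuous_attains_inf[OF compact_cball] by blast
  have uq: "u q > 0" using q(1) half u(4) by blast
  define S where "S = cball (0::'a) r - ball 0 (r/2)"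
  have S: "compact S" "0 \<notin> S"
    using ball(1) by (auto simp: S_def compact_diff)
  obtain \<sigma>0 where \<sigma>0: "\<sigma>0 > 0"
    "\<And>\<sigma> z. 0 < \<sigma> \<Longrightarrow> \<sigma> < \<sigma>0 \<Longrightarrow> z \<in> S \<Longrightarrow> \<sigma> * (\<Sum>b\<in>Basis. dflux (\<sigma> *\<^sub>R z) b \<bullet> b) < m"
    by (rule trace_dflux_scaled_small[OF S m]) blast
  \<comment> \<open>Halving \<sigma>0 gives the strict inequality for the trace estimate; the second
    bound puts the barrier below min u = u q on the inner sphere.\<close>
  define \<sigma> where "\<sigma> = min (\<sigma>0 / 2) (u q / r\<^sup>2)"
  have \<sigma>: "\<sigma> > 0" "\<sigma> < \<sigma>0" using \<sigma>0(1) uq ball(1) by (auto simp: \<sigma>_def)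
  have \<sigma>r: "\<sigma> * r\<^sup>2 \<le> u q"
  proof -
    have "\<sigma> * r\<^sup>2 \<le> u q / r\<^sup>2 * r\<^sup>2" by (intro mult_right_mono) (auto simp: \<sigma>_def)
    then show ?thesis using ball(1) by simp
  qed
  define A where "A = ball c r - cball c (r/2)"
  define v where "v x = \<sigma> / 2 * (r\<^sup>2 - (dist c x)\<^sup>2)" for x
  define w where "w x = \<sigma> *\<^sub>R (c - x)" for x
  \<comment> \<open>The minus sign is the derivative of x \<mapsto> c - x.\<close>
  define F' where "F' x h = - (\<sigma> *\<^sub>R dflux (w x) h)" for x h
  \<comment> \<open>This confines the frontier of \<open>A\<close> to the two spheres of radius r
    and r/2.\<close>
  have clA: "closure A \<subseteq> cball c r - ball c (r/2)"
    by (rule closure_minimal) (auto simp: A_def closed_Diff)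
  have wA: "w x \<noteq> 0" "c - x \<in> S" if "x \<in> A" for x
    using that \<sigma>(1) ball(1) by (auto simp: w_def A_def S_def dist_norm norm_minus_commute[of x c])
  have w': "(w has_derivative (\<lambda>h. - (\<sigma> *\<^sub>R h))) (at x)" for x
    unfolding w_def by (auto intro!: derivative_eq_intros)
  have w_cont: "continuous_on T w" for T
    unfolding w_def by (intro continuous_intros)
  have "v x \<le> u x" if x: "x \<in> A" for x
  proof (rule weak_comparison[where A=A and w=w and F'=F', OF \<Omega>(1) _ _ _ u(1) _ u(3) _ f(1)])
    show "open A" by (simp add: A_def open_Diff)
    show "A \<subseteq> \<Omega>" using ball(2) by (auto simp: A_def)
    show "bounded A" by (simp add: A_def bounded_diff)
    show "continuous_on (closure A) u"
      using clA cball by (intro continuous_on_subset[OF u(2)]) auto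
    show "u z \<ge> 0" if "z \<in> \<Omega>" for z using u(4)[OF that] by simp
    show "continuous_on (closure A) v"
      unfolding v_def by (intro continuous_intros)
    show "(v has_derivative (\<lambda>h. w z \<bullet> h)) (at z)" if "z \<in> A" for z
    proof -
      have "((\<lambda>x. \<sigma> / 2 * (r\<^sup>2 - (c - x) \<bullet> (c - x))) has_derivative (\<lambda>h. w z \<bullet> h)) (at z)"
        by (auto intro!: derivative_eq_intros simp: w_def inner_commute algebra_simps fun_eq_iff)
      then show ?thesis
        by (simp add: v_def[abs_def] dist_norm power2_norm_eq_inner)
    qed
    show "continuous_on A w" by (rule w_cont)
    show "((\<lambda>x. flux B H (w x)) has_derivative F' z) (at z)" if "z \<in> A" for z
    proof -
      note D = has_derivative_flux[OF wA(1)[OF that]]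
      have "((\<lambda>x. flux B H (w x)) has_derivative (\<lambda>h. dflux (w z) (- (\<sigma> *\<^sub>R h)))) (at z)"
        by (rule has_derivative_compose[OF w' D])
      moreover have "dflux (w z) (- (\<sigma> *\<^sub>R h)) = F' z h" for h
        using linear_neg[OF has_derivative_linear[OF D]] linear_scale[OF has_derivative_linear[OF D]]
        by (simp add: F'_def)
      ultimately show ?thesis by simp
    qed
    show "continuous_on A (\<lambda>x. F' x b)" if "b \<in> Basis" for b
      unfolding F'_def
      by (intro continuous_intros continuous_on_compose2[OF continuous_on_dflux[OF that] w_cont])
        (use wA in auto)
    show "(\<Sum>b\<in>Basis. F' z b \<bullet> b) + f (u z) > 0" if "z \<in> A" for z
    proof -
      have "z \<in> cball c r" using that by (simp add: A_def)
      then have "z \<in> closure \<Omega>" using cball by blast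
      then have "m \<le> f (u z)" using p(2) by (simp add: m_def)
      moreover have "\<sigma> * (\<Sum>b\<in>Basis. dflux (w z) b \<bullet> b) < m"
        using \<sigma>0(2)[OF \<sigma> wA(2)[OF that]] by (simp add: w_def)
      moreover have "(\<Sum>b\<in>Basis. F' z b \<bullet> b) = - (\<sigma> * (\<Sum>b\<in>Basis. dflux (w z) b \<bullet> b))"
        by (simp add: F'_def sum_negf sum_distrib_left)
      ultimately show ?thesis by simp
    qed
    show "v z \<le> u z" if "z \<in> frontier A" for z
    proof -
      have "z \<in> closure A" "z \<notin> A"
        using that \<open>open A\<close> by (auto simp: frontier_def interior_open)
      then have z: "z \<in> cball c r" "dist c z = r \<or> dist c z = r / 2"
        using clA by (auto simp: A_def)
      show ?thesis
      \<comment> \<open>On the outer sphere the barrier is 0 and u \<ge> 0; on the inner one the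
        choice of \<sigma> applies.\<close>
      proof (cases "dist c z = r")
        case True
        then show ?thesis using u_nn[of z] z(1) cball by (auto simp: v_def)
      next
        case False
        then have "z \<in> cball c (r/2)" using z(2) by simp
        have "v z \<le> \<sigma> * r\<^sup>2"
          using \<sigma>(1) by (simp add: v_def algebra_simps add_nonneg_nonneg)
        also have "\<dots> \<le> u z" using \<sigma>r q(2)[OF \<open>z \<in> cball c (r/2)\<close>] by simp
        finally show ?thesis .
      qed
    qed
    show "x \<in> A" by (rule x)
  qed
  then show ?thesis
    using that[of \<sigma>] \<sigma>(1) by (simp add: A_def v_def)
qed

end

section \<open>Behaviour at the boundary point\<close>

text \<open>The local defining function is g(z) = z . e - \<phi>(z), the height above the graph.
  Since \<phi> is constant along e, g grows at unit speed along e, so its gradient \<open>N\<close>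
  at y is nonzero.\<close>

lemma smooth_boundary_local_graph:
  assumes "smooth_boundary \<Omega>" "open \<Omega>" "y \<in> frontier \<Omega>"
  obtains \<rho> g N e where "\<rho> > 0" "(g has_derivative (\<lambda>h. N \<bullet> h)) (at y)" "norm e = 1" "N \<bullet> e = 1"
    "g y = 0" "\<And>z t. g (z + t *\<^sub>R e) = g z + t" "\<And>z. z \<in> ball y \<rho> \<Longrightarrow> z \<in> \<Omega> \<longleftrightarrow> g z > 0"
proof -
  obtain \<rho> e \<phi> where \<rho>: "\<rho> > 0" and e: "norm e = 1" and sm: "\<forall>k. Ck_on k UNIV \<phi>"
    and const: "\<forall>z t. \<phi> (z + t *\<^sub>R e) = \<phi> z"
    and graph: "\<Omega> \<inter> ball y \<rho> = {z \<in> ball y \<rho>. \<phi> z < z \<bullet> e}"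
    using bspec[OF assms(1)[unfolded smooth_boundary_def] assms(3)] by blast
  define g where "g z = z \<bullet> e - \<phi> z" for z
  define N where "N = e - grad \<phi> y"
  have g_e: "g (z + t *\<^sub>R e) = g z + t" for z t
    using e by (simp add: g_def const inner_add_left norm_eq_1)
  have g': "(g has_derivative (\<lambda>h. N \<bullet> h)) (at y)"
  proof -
    have "(\<phi> has_derivative (\<lambda>h. grad \<phi> y \<bullet> h)) (at y)"
      using sm Ck_on_1D(1) has_derivative_grad by (metis UNIV_I)
    then have "(g has_derivative (\<lambda>h. h \<bullet> e - grad \<phi> y \<bullet> h)) (at y)"
      unfolding g_def by (intro has_derivative_diff has_derivative_inner_left has_derivative_ident)
    moreover have "(\<lambda>h. h \<bullet> e - grad \<phi> y \<bullet> h) = (\<lambda>h. N \<bullet> h)"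
      by (simp add: N_def inner_diff_left inner_commute[of e] fun_eq_iff)
    ultimately show ?thesis by simp
  qed
  have iff: "z \<in> \<Omega> \<longleftrightarrow> g z > 0" if "z \<in> ball y \<rho>" for z
    using eqset_imp_iff[OF graph, of z] that by (simp add: g_def)
  have "N \<bullet> e = 1"
  proof -
    have p: "((\<lambda>t::real. y + t *\<^sub>R e) has_derivative (\<lambda>s. s *\<^sub>R e)) (at 0)"
      by (auto intro!: derivative_eq_intros)
    have "((\<lambda>t. g (y + t *\<^sub>R e)) has_derivative (\<lambda>s. N \<bullet> (s *\<^sub>R e))) (at 0)"
      by (rule has_derivative_compose[OF p]) (use g' in simp)
    moreover have "((\<lambda>t. g (y + t *\<^sub>R e)) has_derivative (\<lambda>s. s)) (at 0)"
      unfolding g_e by (auto intro!: derivative_eq_intros)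
    ultimately have "(\<lambda>s. N \<bullet> (s *\<^sub>R e)) = (\<lambda>s. s)"
      by (rule has_derivative_unique)
    from fun_cong[OF this, of 1] show ?thesis by simp
  qed
  \<comment> \<open>As y lies outside the open set \<Omega>, g y \<le> 0. If g y < 0, then g < 0
    near y, and y could not be in the closure of \<Omega>.\<close>
  moreover have "g y = 0"
  proof (rule antisym)
    have "y \<notin> \<Omega>" using assms(2,3) by (simp add: frontier_def interior_open)
    then show "g y \<le> 0" using iff[of y] \<rho> by simp
    show "0 \<le> g y"
    proof (rule ccontr)
      assume "\<not> 0 \<le> g y"
      moreover have "(g \<longlongrightarrow> g y) (at y)"
        using has_derivative_continuous[OF g'] by (simp add: continuous_within)
      ultimately have "\<forall>\<^sub>F z in at y. g z < 0"
        by (intro order_tendstoD) auto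
      then obtain d where d: "d > 0" "\<And>z. z \<noteq> y \<Longrightarrow> dist z y < d \<Longrightarrow> g z < 0"
        unfolding eventually_at by auto
      have "y \<in> closure \<Omega>" using assms(3) by (simp add: frontier_def)
      then obtain z where z: "z \<in> \<Omega>" "dist z y < min d \<rho>"
        using d(1) \<rho> unfolding closure_approachable by (metis min_less_iff_conj)
      then have "g z > 0" using iff[of z] by (simp add: dist_commute)
      moreover have "z \<noteq> y" using z(1) \<open>y \<notin> \<Omega>\<close> by auto
      ultimately show False using d(2)[of z] z(2) by auto
    qed
  qed
  ultimately show ?thesis
    using that[of \<rho> g N e] \<rho> g' e g_e iff by blast
qed

text \<open>The vectors \<open>N\<close>, c - y and \<nu> are shown to be positively parallel.
  Directions entering the ball pair nonnegatively with \<open>N\<close>, which forces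
  \<open>N\<close> along c - y; directions orthogonal to \<open>N\<close> are tangent to the
  frontier, which forces \<nu> along \<open>N\<close>.\<close>

lemma inner_unit_normal_interior_sphere:
  fixes \<Omega> :: "'a::euclidean_space set"
  assumes \<Omega>: "smooth_boundary \<Omega>" "open \<Omega>" "y \<in> frontier \<Omega>"
    and ball: "r > 0" "ball c r \<subseteq> \<Omega>" "dist c y = r"
    and \<nu>: "inner_unit_normal \<Omega> y \<nu>"
  shows "c - y = r *\<^sub>R \<nu>"
proof -
  obtain \<rho> g N e where \<rho>: "\<rho> > 0" and g': "(g has_derivative (\<lambda>h. N \<bullet> h)) (at y)"
    and e: "norm e = 1" "N \<bullet> e = 1" and g0: "g y = 0"
    and g_e: "\<And>z t. g (z + t *\<^sub>R e) = g z + t"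
    and iff: "\<And>z. z \<in> ball y \<rho> \<Longrightarrow> z \<in> \<Omega> \<longleftrightarrow> g z > 0"
    using smooth_boundary_local_graph[OF \<Omega>] by metis
  define w where "w = c - y"
  have w: "norm w = r" "w \<noteq> 0" using ball by (auto simp: w_def dist_norm)
  have line: "((\<lambda>t::real. y + t *\<^sub>R d) has_derivative (\<lambda>s. s *\<^sub>R d)) (at 0)" for d
    by (auto intro!: derivative_eq_intros)
  have g_line: "((\<lambda>t. g (y + t *\<^sub>R d)) has_real_derivative N \<bullet> d) (at 0)" for d
  proof -
    have "((\<lambda>t. g (y + t *\<^sub>R d)) has_derivative (\<lambda>s. N \<bullet> (s *\<^sub>R d))) (at 0)"
      by (rule has_derivative_compose[OF line]) (use g' in simp)
    then show ?thesis
      by (simp add: has_field_derivative_def mult_commute_abs)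
  qed
  have inward: "N \<bullet> d \<ge> 0" if \<epsilon>: "\<epsilon> > 0" "\<And>t. 0 < t \<Longrightarrow> t < \<epsilon> \<Longrightarrow> y + t *\<^sub>R d \<in> \<Omega>" for d \<epsilon>
  proof -
    have "((\<lambda>t. (g (y + t *\<^sub>R d) - g y) / t) \<longlongrightarrow> N \<bullet> d) (at_right 0)"
      using g_line[of d] unfolding DERIV_def by (auto intro: tendsto_mono[OF at_le])
    moreover have "\<forall>\<^sub>F t in at_right 0. 0 \<le> (g (y + t *\<^sub>R d) - g y) / t"
    proof -
      \<comment> \<open>Keeps the segment inside the ball where \<open>g\<close> describes \<Omega>;
        the + 1 admits d = 0.\<close>
      define \<delta> where "\<delta> = min \<epsilon> (\<rho> / (norm d + 1))"
      have \<delta>: "\<delta> > 0" using \<epsilon> \<rho> by (simp add: \<delta>_def add_nonneg_pos)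
      have "0 \<le> (g (y + t *\<^sub>R d) - g y) / t" if t: "0 < t" "t < \<delta>" for t
      proof -
        have "t * norm d \<le> t * (norm d + 1)" using t by simp
        also have "\<dots> < \<rho>"
          using t by (simp add: \<delta>_def pos_less_divide_eq add_nonneg_pos)
        finally have "y + t *\<^sub>R d \<in> ball y \<rho>" using t by (simp add: dist_norm)
        then have "g (y + t *\<^sub>R d) > 0" 
          using iff[THEN iffD1, OF _ \<epsilon>(2)[of t]] t by (simp add: \<delta>_def)
        then show ?thesis using t g0 by simp
      qed
      then show ?thesis
        using \<delta> unfolding eventually_at_right_field by blast
    qed
    ultimately show ?thesis
      by (rule tendsto_lowerbound) simp
  qed
  have into_ball: "N \<bullet> d \<ge> 0" if d: "d \<bullet> w > 0" for d
  proof -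
    have "d \<noteq> 0" using d by auto
    show ?thesis
    proof (rule inward)
      \<comment> \<open>This is the parameter at which the ray from y in direction d leaves the ball
        again.\<close>
      show "2 * (d \<bullet> w) / (norm d)\<^sup>2 > 0" using d \<open>d \<noteq> 0\<close> by simp
      fix t :: real assume t: "0 < t" "t < 2 * (d \<bullet> w) / (norm d)\<^sup>2"
      have "(norm (w - t *\<^sub>R d))\<^sup>2 = r\<^sup>2 - t * (2 * (d \<bullet> w) - t * (norm d)\<^sup>2)"
        unfolding w(1)[symmetric] power2_norm_eq_inner
        by (simp add: inner_diff_left inner_diff_right inner_commute algebra_simps)
      moreover have "0 < 2 * (d \<bullet> w) - t * (norm d)\<^sup>2"
        using t \<open>d \<noteq> 0\<close> by (simp add: pos_less_divide_eq)
      ultimately have "(norm (w - t *\<^sub>R d))\<^sup>2 < r\<^sup>2" using t(1) by simp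
      then have "norm (w - t *\<^sub>R d) < r" using ball(1) by (simp add: power_less_imp_less_base)
      then have "y + t *\<^sub>R d \<in> ball c r" by (simp add: dist_norm w_def algebra_simps)
      then show "y + t *\<^sub>R d \<in> \<Omega>" using ball(2) by blast
    qed
  qed
  define \<alpha> where "\<alpha> = (N \<bullet> w) / (w \<bullet> w)"
  \<comment> \<open>The component of \<open>N\<close> orthogonal to w.\<close>
  define P where "P = N - \<alpha> *\<^sub>R w"
  have Pw: "P \<bullet> w = 0" using w by (simp add: P_def \<alpha>_def inner_diff_left)
  have NP: "N \<bullet> P = P \<bullet> P"
    using Pw by (simp add: P_def inner_diff_left inner_commute)
  have "P = 0"
  proof (rule ccontr)
    assume "P \<noteq> 0"
    \<comment> \<open>Tilting w by -T P keeps its product with w positive, while T is solved from N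
      . (w - T P) = -1, contradicting \<open>into_ball\<close>.\<close>
    define T where "T = (N \<bullet> w + 1) / (P \<bullet> P)"
    have "(w - T *\<^sub>R P) \<bullet> w > 0" using Pw w by (simp add: inner_diff_left)
    then have "0 \<le> N \<bullet> (w - T *\<^sub>R P)" by (rule into_ball)
    also have "\<dots> = -1" using \<open>P \<noteq> 0\<close> by (simp add: inner_diff_right NP T_def)
    finally show False by simp
  qed
  then have Nw: "N = \<alpha> *\<^sub>R w" by (simp add: P_def)
  have N0: "N \<noteq> 0" using e(2) by auto
  have "\<alpha> \<ge> 0" using into_ball[of w] w by (simp add: \<alpha>_def)
  then have \<alpha>: "\<alpha> > 0" using N0 Nw by (cases "\<alpha> = 0") auto
  \<comment> \<open>A zero of \<open>g\<close> is a limit of points of \<Omega>: moving \<delta>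
    along e raises \<open>g\<close> to \<delta> > 0.\<close>
  have frontier: "z \<in> frontier \<Omega>" if z: "z \<in> ball y \<rho>" "g z = 0" for z
  proof -
    have "z \<in> closure \<Omega>"
      unfolding closure_approachable
    proof (intro allI impI)
      fix d :: real assume "d > 0"
      define \<delta> where "\<delta> = min d (\<rho> - dist y z) / 2"
      have \<delta>: "0 < \<delta>" "\<delta> < d" "\<delta> < \<rho> - dist y z"
        using z(1) \<open>d > 0\<close> by (auto simp: \<delta>_def min_def)
      have dz: "dist z (z + \<delta> *\<^sub>R e) = \<delta>" using \<delta> e by (simp add: dist_norm)
      have "dist y (z + \<delta> *\<^sub>R e) \<le> dist y z + \<delta>"
        using dist_triangle[of y "z + \<delta> *\<^sub>R e" z] dz by simp
      then have "z + \<delta> *\<^sub>R e \<in> \<Omega>" using iff \<delta> g_e[of z \<delta>] z(2) by simp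
      then show "\<exists>x\<in>\<Omega>. dist x z < d" using dz \<delta> by (metis dist_commute)
    qed
    moreover have "z \<notin> \<Omega>" using iff z by simp
    ultimately show ?thesis using \<Omega>(2) by (simp add: frontier_def interior_open)
  qed
  have tangent: "\<tau> \<in> tangent_vectors (frontier \<Omega>) y" if \<tau>: "N \<bullet> \<tau> = 0" for \<tau>
  proof -
    \<comment> \<open>The straight line is corrected along e so as to stay on g = 0. The correction
      has derivative -(N . \<tau>) = 0 at 0, so the velocity is still \<tau>.\<close>
    define \<gamma> where "\<gamma> t = y + t *\<^sub>R \<tau> + (- g (y + t *\<^sub>R \<tau>)) *\<^sub>R e" for t
    have "((\<lambda>t. g (y + t *\<^sub>R \<tau>)) has_derivative (\<lambda>s. 0)) (at 0)"
      using g_line[of \<tau>] \<tau> by (simp add: has_field_derivative_def lambda_zero)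
    then have "(\<gamma> has_derivative (\<lambda>s. s *\<^sub>R \<tau> + (- 0) *\<^sub>R e)) (at 0)"
      unfolding \<gamma>_def
      by (intro has_derivative_add line has_derivative_scaleR_left has_derivative_minus)
    then have \<gamma>': "(\<gamma> has_vector_derivative \<tau>) (at 0)"
      by (simp add: has_vector_derivative_def)
    have \<gamma>0: "\<gamma> 0 = y" using g0 by (simp add: \<gamma>_def)
    have "continuous (at 0) \<gamma>" using \<gamma>' has_vector_derivative_continuous by blast
    then obtain \<epsilon> where \<epsilon>: "\<epsilon> > 0" "\<And>t. dist t 0 < \<epsilon> \<Longrightarrow> dist (\<gamma> t) y < \<rho>"
      using \<rho> \<gamma>0 unfolding continuous_at_eps_delta by metis
    have "\<gamma> t \<in> frontier \<Omega>" if "t \<in> {-\<epsilon><..<\<epsilon>}" for t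
    proof (rule frontier)
      show "\<gamma> t \<in> ball y \<rho>" using \<epsilon>(2)[of t] that by (auto simp: dist_commute dist_real_def)
      show "g (\<gamma> t) = 0" unfolding \<gamma>_def g_e by simp
    qed
    then show ?thesis
      unfolding tangent_vectors_def using \<epsilon>(1) \<gamma>0 \<gamma>' by blast
  qed
  have n1: "norm \<nu> = 1" and orth: "\<And>v. v \<in> tangent_vectors (frontier \<Omega>) y \<Longrightarrow> \<nu> \<bullet> v = 0"
    using \<nu> by (auto simp: inner_unit_normal_def)
  obtain \<epsilon> where \<epsilon>: "\<epsilon> > 0" "\<And>t. 0 < t \<Longrightarrow> t < \<epsilon> \<Longrightarrow> y + t *\<^sub>R \<nu> \<in> \<Omega>"
    using \<nu> unfolding inner_unit_normal_def by auto
  have N\<nu>: "N \<bullet> \<nu> \<ge> 0" by (rule inward[OF \<epsilon>])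
  define \<kappa> where "\<kappa> = (N \<bullet> \<nu>) / (N \<bullet> N)"
  \<comment> \<open>The part of \<nu> orthogonal to \<open>N\<close>. It is tangent, hence
    orthogonal to \<nu> as well, hence 0.\<close>
  define \<tau> where "\<tau> = \<nu> - \<kappa> *\<^sub>R N"
  have N\<tau>: "N \<bullet> \<tau> = 0" using N0 by (simp add: \<tau>_def \<kappa>_def inner_diff_right)
  then have "\<nu> \<bullet> \<tau> = 0" using tangent orth by blast
  then have "\<tau> \<bullet> \<tau> = 0" using N\<tau> unfolding \<tau>_def by (simp add: inner_diff_left)
  then have \<nu>N: "\<nu> = (\<kappa> * \<alpha>) *\<^sub>R w" using Nw by (simp add: \<tau>_def)
  have "\<kappa> \<ge> 0" using N\<nu> by (simp add: \<kappa>_def)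
  then have "\<kappa> * \<alpha> * r = 1" using n1 w \<alpha> unfolding \<nu>N by (simp add: abs_mult)
  then have "r *\<^sub>R \<nu> = w" unfolding \<nu>N by (simp add: mult.commute mult.left_commute)
  then show ?thesis by (simp add: w_def)
qed

text \<open>Inside \<Omega> the derivative along the ray is grad u . \<nu>, which extends
  continuously to y; l'Hopital's rule then gives the one-sided derivative V y . \<nu>. This settles
  existence; the sign comes from the barrier.\<close>

lemma C1_closure_on_right_derivative:
  assumes \<Omega>: "open \<Omega>" "y \<in> closure \<Omega>" and u: "C1_closure_on \<Omega> u"
    and \<epsilon>: "\<epsilon> > 0" "\<And>t. 0 < t \<Longrightarrow> t < \<epsilon> \<Longrightarrow> y + t *\<^sub>R \<nu> \<in> \<Omega>"
  shows "\<exists>d. ((\<lambda>t. u (y + t *\<^sub>R \<nu>)) has_real_derivative d) (at_right 0)"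
proof -
  obtain V where V: "continuous_on (closure \<Omega>) V" "\<And>x. x \<in> \<Omega> \<Longrightarrow> V x = grad u x"
    and C1: "Ck_on 1 \<Omega> u" and uc: "continuous_on (closure \<Omega>) u"
    using u unfolding C1_closure_on_def by blast
  have ev: "\<forall>\<^sub>F t in at_right 0. y + t *\<^sub>R \<nu> \<in> \<Omega>"
    using \<epsilon> unfolding eventually_at_right_field by blast
  have lim: "((\<lambda>t. k (y + t *\<^sub>R \<nu>)) \<longlongrightarrow> k y) (at_right 0)"
    if "continuous_on (closure \<Omega>) k" for k :: "_ \<Rightarrow> 'b::topological_space"
  proof -
    have "((\<lambda>t::real. y + t *\<^sub>R \<nu>) \<longlongrightarrow> y + 0 *\<^sub>R \<nu>) (at_right 0)"
      by (intro tendsto_intros)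
    moreover have "\<forall>\<^sub>F t in at_right 0. y + t *\<^sub>R \<nu> \<in> closure \<Omega>"
      using ev by (rule eventually_mono) (use closure_subset in blast)
    ultimately show ?thesis
      using continuous_on_tendsto_compose[OF that _ \<Omega>(2), of "\<lambda>t. y + t *\<^sub>R \<nu>" "at_right 0"] by simp
  qed
  have "((\<lambda>t. (u (y + t *\<^sub>R \<nu>) - u y) / t) \<longlongrightarrow> V y \<bullet> \<nu>) (at_right 0)"
  proof (rule lhopital_right_0[where f'="\<lambda>t. V (y + t *\<^sub>R \<nu>) \<bullet> \<nu>" and g'="\<lambda>_. 1"])
    show "((\<lambda>t. u (y + t *\<^sub>R \<nu>) - u y) \<longlongrightarrow> 0) (at_right 0)"
      using tendsto_diff[OF lim[OF uc] tendsto_const[of "u y"]] by simp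
    show "((\<lambda>t::real. t) \<longlongrightarrow> 0) (at_right 0)" by (rule tendsto_ident_at)
    show "\<forall>\<^sub>F t in at_right 0. t \<noteq> (0::real)"
      by (auto simp: eventually_at_filter)
    show "\<forall>\<^sub>F t in at_right (0::real). (1::real) \<noteq> 0" by simp
    show "\<forall>\<^sub>F t in at_right 0. ((\<lambda>t. u (y + t *\<^sub>R \<nu>) - u y) has_real_derivative V (y + t *\<^sub>R \<nu>) \<bullet> \<nu>) (at t)"
      using ev
    proof eventually_elim
      case (elim t)
      have p: "((\<lambda>t::real. y + t *\<^sub>R \<nu>) has_derivative (\<lambda>s. s *\<^sub>R \<nu>)) (at t)"
        by (auto intro!: derivative_eq_intros)
      have "((\<lambda>t. u (y + t *\<^sub>R \<nu>)) has_derivative (\<lambda>s. grad u (y + t *\<^sub>R \<nu>) \<bullet> (s *\<^sub>R \<nu>))) (at t)"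
        using has_derivative_compose[OF p has_derivative_grad[OF Ck_on_1D(1)[OF C1 elim]]] .
      then have "((\<lambda>t. u (y + t *\<^sub>R \<nu>)) has_real_derivative V (y + t *\<^sub>R \<nu>) \<bullet> \<nu>) (at t)"
        by (simp add: has_field_derivative_def mult_commute_abs V(2)[OF elim])
      then show ?case
        by (auto intro!: derivative_eq_intros)
    qed
    show "\<forall>\<^sub>F t::real in at_right 0. ((\<lambda>t. t) has_real_derivative 1) (at t)"
      by (auto intro!: always_eventually)
    show "((\<lambda>t. V (y + t *\<^sub>R \<nu>) \<bullet> \<nu> / 1) \<longlongrightarrow> V y \<bullet> \<nu>) (at_right 0)"
      using lim[OF V(1)] by (auto intro!: tendsto_intros)
  qed
  then show ?thesis
    by (auto simp: has_field_derivative_iff)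
qed

section \<open>Strict positivity of the inner normal derivative\<close>

theorem theorem4p5:
  fixes \<Omega> :: "(real ^ 'n) set"
    and H u :: "real ^ 'n \<Rightarrow> real"
    and B f :: "real \<Rightarrow> real"
    and \<beta>0 :: real
    and y \<nu> :: "real ^ 'n"
  assumes dim: "CARD('n) \<ge> 2"
    and domain: "smooth_bounded_domain \<Omega>"
    and beta0: "0 < \<beta>0" "\<beta>0 < 1"
    and B_reg: "Ck_Holder_loc_on 3 \<beta>0 {0<..} B" "C1_ge0 B"
    and B_zero: "B 0 = 0" "deriv_ge0 B 0 = 0"
    and B_pos: "\<forall>t>0. B t > 0 \<and> deriv_ge0 B t > 0 \<and> deriv_ge0 (deriv_ge0 B) t > 0"
    and B_growth: "\<exists>p k \<gamma>0 \<Gamma>0. p > 1 \<and> k \<in> {0..1} \<and> \<gamma>0 > 0 \<and> \<Gamma>0 > 0 \<and>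
        (\<forall>t>0. \<gamma>0 * (k + t) powr (p - 2) * t \<le> deriv_ge0 B t \<and>
               deriv_ge0 B t \<le> \<Gamma>0 * (k + t) powr (p - 2) * t \<and>
               \<gamma>0 * (k + t) powr (p - 2) \<le> deriv_ge0 (deriv_ge0 B) t \<and>
               deriv_ge0 (deriv_ge0 B) t \<le> \<Gamma>0 * (k + t) powr (p - 2))"
    and H_reg: "Ck_Holder_loc_on 3 \<beta>0 (- {0}) H"
    and H_even: "\<forall>\<xi>. H (- \<xi>) = H \<xi>"
    and H_pos: "\<forall>\<xi>. \<xi> \<noteq> 0 \<longrightarrow> H \<xi> > 0" "H 0 = 0"
    and H_hom: "\<forall>\<xi> t. \<xi> \<noteq> 0 \<and> t > 0 \<longrightarrow> H (t *\<^sub>R \<xi>) = t * H \<xi>"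
    and H_unif_convex: "\<exists>\<Lambda>>0. \<forall>\<xi> v. H \<xi> = 1 \<and> grad H \<xi> \<bullet> v = 0 \<longrightarrow>
        frechet_derivative (grad H) (at \<xi>) v \<bullet> v \<ge> \<Lambda> * (norm v)\<^sup>2"
    and f_pos: "\<forall>s\<ge>0. f s > 0"
    and f_cont: "continuous_on {0..} f"
    and f_lipschitz: "\<forall>s>0. \<exists>r>0. \<exists>C. C-lipschitz_on (ball s r \<inter> {0<..}) f"
    and f_g: "\<exists>\<delta>>0. \<exists>g. continuous_on {0..} g \<and> mono_on {0<..<\<delta>} g \<and> g 0 = 0 \<and>
        (\<forall>s\<ge>0. f s + g s \<ge> 0) \<and> zero_or_divergent B g \<delta>"
    and u_reg: "C1_closure_on \<Omega> u"
    and u_sol: "weak_solution B H f \<Omega> u"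
    and u_pos: "\<forall>x\<in>\<Omega>. u x > 0"
    and u_bdry: "\<forall>x\<in>frontier \<Omega>. u x = 0"
    and y_bdry: "y \<in> frontier \<Omega>"
    and y_sphere: "interior_sphere_condition \<Omega> y"
    and normal: "inner_unit_normal \<Omega> y \<nu>"
  shows "\<exists>d. ((\<lambda>t. u (y + t *\<^sub>R \<nu>)) has_real_derivative d) (at_right 0) \<and> d > 0"
proof -
  obtain p k \<gamma>0 \<Gamma>0 where g0: "\<gamma>0 > 0" "\<Gamma>0 > 0" and
    growth: "\<forall>t>0. \<gamma>0 * (k + t) powr (p - 2) * t \<le> deriv_ge0 B t \<and>
               deriv_ge0 B t \<le> \<Gamma>0 * (k + t) powr (p - 2) * t \<and>
               \<gamma>0 * (k + t) powr (p - 2) \<le> deriv_ge0 (deriv_ge0 B) t \<and>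
               deriv_ge0 (deriv_ge0 B) t \<le> \<Gamma>0 * (k + t) powr (p - 2)"
    using B_growth by blast
  \<comment> \<open>The upper bound for B'' and the lower bound for B' share the factor (k +
    t)^(p-2), so their quotient leaves the constant M = \<Gamma>0 / \<gamma>0.\<close>
  have ratio: "t * deriv_ge0 (deriv_ge0 B) t \<le> \<Gamma>0 / \<gamma>0 * deriv_ge0 B t" if t: "t > 0" for t
  proof -
    have "t * deriv_ge0 (deriv_ge0 B) t \<le> t * (\<Gamma>0 * (k + t) powr (p - 2))"
      using growth t by (intro mult_left_mono) auto
    also have "\<dots> = \<Gamma>0 / \<gamma>0 * (\<gamma>0 * (k + t) powr (p - 2) * t)"
      using g0 by simp
    also have "\<dots> \<le> \<Gamma>0 / \<gamma>0 * deriv_ge0 B t"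
      using growth t g0 by (intro mult_left_mono) auto
    finally show ?thesis .
  qed
  obtain \<Lambda> where \<Lambda>: "\<Lambda> > 0" "\<And>\<xi> v. H \<xi> = 1 \<Longrightarrow> grad H \<xi> \<bullet> v = 0 \<Longrightarrow>
      \<Lambda> * (norm v)\<^sup>2 \<le> frechet_derivative (grad H) (at \<xi>) v \<bullet> v"
    using H_unif_convex by blast
  have convex: "0 \<le> frechet_derivative (grad H) (at \<xi>) v \<bullet> v" if "H \<xi> = 1" "grad H \<xi> \<bullet> v = 0" for \<xi> v
    using \<Lambda>(2)[OF that] \<Lambda>(1) by (meson less_imp_le mult_nonneg_nonneg order_trans zero_le_power2)
  interpret anisotropic_energy B H "\<Gamma>0 / \<gamma>0"
  proof
    show "continuous_on {0..} (deriv_ge0 B)" using B_reg(2) by (simp add: C1_ge0_def)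
  qed (use Ck_Holder_loc_on_3_deriv_ge0[OF B_reg(1)] Ck_Holder_loc_on_3_grad[OF H_reg]
      B_zero B_pos ratio H_pos H_hom convex in auto)
  have open_\<Omega>: "open \<Omega>" and bounded_\<Omega>: "bounded \<Omega>" and smooth: "smooth_boundary \<Omega>"
    using domain by (auto simp: smooth_bounded_domain_def)
  obtain c r where r: "r > 0" "ball c r \<subseteq> \<Omega>" "y \<in> frontier (ball c r)"
    using y_sphere by (auto simp: interior_sphere_condition_def)
  then have dist_y: "dist c y = r" by simp
  have normal_eq: "c - y = r *\<^sub>R \<nu>"
    by (rule inner_unit_normal_interior_sphere[OF smooth open_\<Omega> y_bdry r(1,2) dist_y normal])
  have \<nu>1: "norm \<nu> = 1" using normal by (simp add: inner_unit_normal_def)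
  \<comment> \<open>Because c = y + r \<nu>, moving along \<nu> means moving radially towards the
    centre.\<close>
  have dist_ray: "dist c (y + t *\<^sub>R \<nu>) = r - t" if "t < r" for t
  proof -
    have "c - (y + t *\<^sub>R \<nu>) = (r - t) *\<^sub>R \<nu>"
      using normal_eq by (simp add: algebra_simps)
    then show ?thesis using that \<nu>1 by (simp add: dist_norm)
  qed
  have "y \<in> closure \<Omega>" using y_bdry by (simp add: frontier_def)
  moreover have "y + t *\<^sub>R \<nu> \<in> \<Omega>" if "0 < t" "t < r" for t
    using dist_ray[OF that(2)] that(1) r(2) by (auto simp: subset_iff)
  ultimately obtain d where d: "((\<lambda>t. u (y + t *\<^sub>R \<nu>)) has_real_derivative d) (at_right 0)"
    using C1_closure_on_right_derivative[OF open_\<Omega> _ u_reg r(1)] by blast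
  have "Ck_on 1 \<Omega> u" "continuous_on (closure \<Omega>) u"
    using u_reg by (auto simp: C1_closure_on_def)
  then obtain \<sigma> where \<sigma>: "\<sigma> > 0"
    "\<And>x. r / 2 < dist c x \<Longrightarrow> dist c x < r \<Longrightarrow> \<sigma> / 2 * (r\<^sup>2 - (dist c x)\<^sup>2) \<le> u x"
    using paraboloid_lower_bound[OF r(1,2) open_\<Omega> bounded_\<Omega> _ _ u_sol _ _ f_cont] u_pos u_bdry f_pos
    by metis
  have "((\<lambda>t. (u (y + t *\<^sub>R \<nu>) - u y) / t) \<longlongrightarrow> d) (at_right 0)"
    using d by (simp add: has_field_derivative_iff)
  moreover have "\<forall>\<^sub>F t in at_right 0. \<sigma> * r / 2 \<le> (u (y + t *\<^sub>R \<nu>) - u y) / t"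
  proof -
    \<comment> \<open>For t < r/2 the point is in the annulus, and r\<le> 2 r - t gives half the
      barrier's slope \<sigma> r as a lower bound uniform in t.\<close>
    have "\<sigma> * r / 2 \<le> (u (y + t *\<^sub>R \<nu>) - u y) / t" if t: "0 < t" "t < r / 2" for t
    proof -
      have "\<sigma> * r / 2 * t \<le> \<sigma> / 2 * (t * (2 * r - t))"
        using \<sigma>(1) t by (simp add: mult.assoc mult.left_commute[of t])
      also have "\<dots> = \<sigma> / 2 * (r\<^sup>2 - (r - t)\<^sup>2)"
        by (simp add: power2_eq_square algebra_simps)
      also have "\<dots> \<le> u (y + t *\<^sub>R \<nu>)"
        using \<sigma>(2)[of "y + t *\<^sub>R \<nu>"] dist_ray[of t] t by simp
      finally show ?thesis
        using t u_bdry y_bdry by (simp add: pos_le_divide_eq)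
    qed
    moreover have "0 < r / 2" using r(1) by simp
    ultimately show ?thesis
      unfolding eventually_at_right_field by blast
  qed
  ultimately have "\<sigma> * r / 2 \<le> d"
    by (rule tendsto_lowerbound) simp
  moreover have "0 < \<sigma> * r / 2" using \<sigma>(1) r(1) by simp
  ultimately show ?thesis using d by (meson less_le_trans)
qed

end
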